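(* Let $\varphi$ be a free holomorphic self-map of the noncommutative ball $[B(\mathcal H)^n]_1$ and let $C_\varphi$ be the composition operator on $H^2_{\bf ball}$. Then the following statements hold. (i) The essential norm of $C_\varphi$ on $H^2_{\bf ball}$ satisfies the inequality $$\|C_\varphi\|_e\ge\limsup_{\|\lambda\|\to1}\left(\frac{1-\|\lambda\|^2}{1-\|\varphi(\lambda)\|^2}\right)^{1/2}\qquad(\lambda\in\mathbb B_n).$$ (ii) If $C_\varphi$ is a compact operator on $H^2_{\bf ball}$, then the scalar representation of $\varphi$ cannot have finite angular derivative at any point of $\partial\mathbb B_n$.
   Context: $n\ge1$; $\mathcal H$ is a separable infinite dimensional complex Hilbert space. $\mathbb F_n^+$ is the free semigroup with generators $g_1,\ldots,g_n$ and identity $g_0$; $|g_0|=0$, $|\alpha|=k$ if $\alpha=g_{i_1}\cdots g_{i_k}$; $X_\alpha:=X_{i_1}\cdots X_{i_k}$, $X_{g_0}:=I$. $[B(\mathcal H)^n]_1:=\{(X_1,\ldots,X_n)\in B(\mathcal H)^n:\ \|X_1X_1^*+\cdots+X_nX_n^*\|^{1/2}<1\}$. A free holomorphic function $f:[B(\mathcal H)^n]_1\to B(\mathcal H)$ is a map $f(X)=\sum_{k=0}^\infty\sum_{|\alpha|=k}a_\alpha X_\alpha$ (series over $k$ converging in operator norm) with $a_\alpha\in\mathbb C$ and $\limsup_{k\to\infty}(\sum_{|\alpha|=k}|a_\alpha|^2)^{1/2k}\le1$. A free holomorphic self-map $\varphi=(\varphi_1,\ldots,\varphi_n)$ of $[B(\mathcal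 H)^n]_1$ has each $\varphi_i$ free holomorphic and maps $[B(\mathcal H)^n]_1$ into itself. With $\varphi_\alpha:=\varphi_{i_1}\cdots\varphi_{i_k}$, the composition is $(f\circ\varphi)(X)=\sum_{k=0}^\infty\sum_{|\alpha|=k}a_\alpha\varphi_\alpha(X)$. $H^2_{\bf ball}$ is the Hilbert space of free holomorphic functions $f=\sum_\alpha a_\alpha X_\alpha$ on $[B(\mathcal H)^n]_1$ with $\|f\|_2^2:=\sum_\alpha|a_\alpha|^2<\infty$; $C_\varphi f:=f\circ\varphi$ is a bounded operator on $H^2_{\bf ball}$. The essential norm is $\|T\|_e:=\inf\{\|T-K\|:\ K\text{ compact}\}$. $\mathbb B_n$ is the open Euclidean unit ball of $\mathbb C^n$; identifying $\lambda\in\mathbb B_n$ with $(\lambda_1I,\ldots,\lambda_nI)$, the scalar representation of $\varphi$ is the holomorphic map $\mathbb B_n\ni\lambda\mapsto\varphi(\lambda)\in\mathbb B_n$. A holomorphic map $\psi:\mathbb B_n\to\mathbb B_n$ has finite angular derivative at $\xi\in\partial\mathbb B_n$ if and only if (Julia–Carathéodory theorem in $\mathbb B_n$; take this as the definition) $\liminf_{\lambda\to\xi}\frac{1-\|\psi(\lambda)\|}{1-\|\lambda\|}<\infty$, where $\lambda\to\xi$ unrestrictedly in $\mathbb B_n$. *)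

theory Defs
  imports "HOL-Analysis.Analysis"
begin

section \<open>Complex Hilbert spaces\<close>

text \<open>
  The distribution only has real inner product spaces. A complex Hilbert space is a complete real
  one that carries in addition a complex scalar multiplication extending the real one, and a
  sesquilinear form (linear in the first argument) with real part \<open>inner\<close>. The norm is then
  automatically the one induced by \<open>cinner\<close>.
\<close>

class complex_hilbert = real_inner + complete_space +
  fixes scaleC :: "complex \<Rightarrow> 'a \<Rightarrow> 'a"  (infixr \<open>*\<^sub>C\<close> 75)
    and cinner :: "'a \<Rightarrow> 'a \<Rightarrow> complex"
  assumes scaleC_add_right: "c *\<^sub>C (x + y) = c *\<^sub>C x + c *\<^sub>C y"
    and scaleC_add_left: "(c + d) *\<^sub>C x = c *\<^sub>C x + d *\<^sub>C x"
    and scaleC_scaleC: "c *\<^sub>C d *\<^sub>C x = (c * d) *\<^sub>C x"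
    and scaleC_one: "1 *\<^sub>C x = x"
    and scaleR_eq_scaleC: "scaleR r x = complex_of_real r *\<^sub>C x"
    and cinner_commute: "cinner x y = cnj (cinner y x)"
    and cinner_add_left: "cinner (x + y) z = cinner x z + cinner y z"
    and cinner_scaleC_left: "cinner (c *\<^sub>C x) y = c * cinner x y"
    and inner_eq_Re_cinner: "inner x y = Re (cinner x y)"

global_interpretation complex_vector: vector_space "scaleC :: complex \<Rightarrow> 'a \<Rightarrow> 'a :: complex_hilbert"
  defines cspan = complex_vector.span
  by unfold_locales (simp_all add: scaleC_add_right scaleC_add_left scaleC_scaleC scaleC_one)

lemma norm_scaleC: "norm (c *\<^sub>C x) = cmod c * norm (x :: 'a :: complex_hilbert)"
proof -
  have im: "Im (cinner x x) = 0"
    using arg_cong[OF cinner_commute[of x x], of Im] by simp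
  have "cinner (c *\<^sub>C x) (c *\<^sub>C x) = c * cnj (c * cinner x x)"
    by (subst cinner_scaleC_left, subst cinner_commute, subst cinner_scaleC_left) (rule refl)
  also have "\<dots> = complex_of_real ((cmod c)\<^sup>2) * cnj (cinner x x)"
    by (simp only: complex_norm_square mult.assoc complex_cnj_mult)
  finally have "inner (c *\<^sub>C x) (c *\<^sub>C x) = (cmod c)\<^sup>2 * inner x x"
    by (simp add: inner_eq_Re_cinner im)
  then show ?thesis
    by (simp add: norm_eq_sqrt_inner real_sqrt_mult)
qed

lemma bounded_linear_scaleC: "bounded_linear (\<lambda>x :: 'a :: complex_hilbert. c *\<^sub>C x)"
  by (rule bounded_linear_intro[where K = "cmod c"])
    (simp_all add: scaleC_add_right scaleR_eq_scaleC scaleC_scaleC norm_scaleC mult.commute)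

section \<open>Operators and the noncommutative ball\<close>

text \<open>
  \<open>B(H)\<close> is the set of complex linear elements of the library type of bounded (real) linear maps;
  its norm there is the operator norm.
\<close>

definition BH :: "('h::complex_hilbert \<Rightarrow>\<^sub>L 'h) set" where
  "BH = {T. \<forall>c x. blinfun_apply T (c *\<^sub>C x) = c *\<^sub>C blinfun_apply T x}"

lift_definition cscale_op :: "complex \<Rightarrow> ('h::complex_hilbert \<Rightarrow>\<^sub>L 'h) \<Rightarrow> ('h \<Rightarrow>\<^sub>L 'h)"
  is "\<lambda>c T x. c *\<^sub>C T x"
  by (rule bounded_linear_compose[OF bounded_linear_scaleC])

definition adj_op :: "('h::complex_hilbert \<Rightarrow>\<^sub>L 'h) \<Rightarrow> ('h \<Rightarrow>\<^sub>L 'h)" where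
  "adj_op T = (THE S. \<forall>x y. cinner (blinfun_apply T x) y = cinner x (blinfun_apply S y))"

type_synonym ('h, 'n) tuple = "('h \<Rightarrow>\<^sub>L 'h)^'n"

definition nc_ball :: "('h::complex_hilbert, 'n::finite) tuple set" where
  "nc_ball = {X. (\<forall>i. X $ i \<in> BH) \<and> sqrt (norm (\<Sum>i\<in>UNIV. X $ i o\<^sub>L adj_op (X $ i))) < 1}"

text \<open>
  The \<open>n\<close> generators of the free semigroup are the elements of the index type \<open>'n\<close>, and words are
  lists, the empty list being the identity.
\<close>

primrec word_op :: "('h::complex_hilbert, 'n::finite) tuple \<Rightarrow> 'n list \<Rightarrow> ('h \<Rightarrow>\<^sub>L 'h)" where
  "word_op X [] = id_blinfun"
| "word_op X (i # \<alpha>) = X $ i o\<^sub>L word_op X \<alpha>"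

section \<open>Free holomorphic functions\<close>

text \<open>Functions on the ball are total functions of which only the values on the ball matter.\<close>

definition has_free_series ::
  "(('h::complex_hilbert, 'n::finite) tuple \<Rightarrow> ('h \<Rightarrow>\<^sub>L 'h)) \<Rightarrow> ('n list \<Rightarrow> complex) \<Rightarrow> bool" where
  "has_free_series f a \<longleftrightarrow>
     limsup (\<lambda>k. ereal ((\<Sum>\<alpha> | length \<alpha> = k. (cmod (a \<alpha>))\<^sup>2) powr (1 / (2 * real k)))) \<le> 1 \<and>
     (\<forall>X\<in>nc_ball. (\<lambda>k. \<Sum>\<alpha> | length \<alpha> = k. cscale_op (a \<alpha>) (word_op X \<alpha>)) sums f X)"

definition free_holomorphic ::
  "(('h::complex_hilbert, 'n::finite) tuple \<Rightarrow> ('h \<Rightarrow>\<^sub>L 'h)) \<Rightarrow> bool" where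
  "free_holomorphic f \<longleftrightarrow> (\<exists>a. has_free_series f a)"

definition free_coeff ::
  "(('h::complex_hilbert, 'n::finite) tuple \<Rightarrow> ('h \<Rightarrow>\<^sub>L 'h)) \<Rightarrow> 'n list \<Rightarrow> complex" where
  "free_coeff f = (THE a. has_free_series f a)"

definition free_self_map ::
  "(('h::complex_hilbert, 'n::finite) tuple \<Rightarrow> ('h, 'n) tuple) \<Rightarrow> bool" where
  "free_self_map \<phi> \<longleftrightarrow>
     (\<forall>i. free_holomorphic (\<lambda>X. \<phi> X $ i)) \<and> (\<forall>X\<in>nc_ball. \<phi> X \<in> nc_ball)"

section \<open>The Hardy space and its operators\<close>

text \<open>
  The elements of the Hardy space are normalised to be 0 off the ball, so that equality in the
  space is equality of HOL functions.
\<close>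

definition H2 :: "(('h::complex_hilbert, 'n::finite) tuple \<Rightarrow> ('h \<Rightarrow>\<^sub>L 'h)) set" where
  "H2 = {f. free_holomorphic f \<and> (\<forall>X. X \<notin> nc_ball \<longrightarrow> f X = 0) \<and>
            (\<lambda>\<alpha>. (cmod (free_coeff f \<alpha>))\<^sup>2) summable_on UNIV}"

definition H2_norm :: "(('h::complex_hilbert, 'n::finite) tuple \<Rightarrow> ('h \<Rightarrow>\<^sub>L 'h)) \<Rightarrow> real" where
  "H2_norm f = sqrt (\<Sum>\<^sub>\<infinity>\<alpha>. (cmod (free_coeff f \<alpha>))\<^sup>2)"

type_synonym ('h, 'n) H2_op =
  "(('h, 'n) tuple \<Rightarrow> ('h \<Rightarrow>\<^sub>L 'h)) \<Rightarrow> (('h, 'n) tuple \<Rightarrow> ('h \<Rightarrow>\<^sub>L 'h))"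

definition H2_linear :: "('h::complex_hilbert, 'n::finite) H2_op \<Rightarrow> bool" where
  "H2_linear T \<longleftrightarrow>
     (\<forall>f\<in>H2. T f \<in> H2) \<and>
     (\<forall>f\<in>H2. \<forall>g\<in>H2. T (\<lambda>X. f X + g X) = (\<lambda>X. T f X + T g X)) \<and>
     (\<forall>c. \<forall>f\<in>H2. T (\<lambda>X. cscale_op c (f X)) = (\<lambda>X. cscale_op c (T f X)))"

text \<open>
  The operator norm is the least bound; it is \<open>\<infinity>\<close> (infimum of the empty set) for a map that does not
  send the Hardy space boundedly into itself.
\<close>

definition H2_opnorm :: "('h::complex_hilbert, 'n::finite) H2_op \<Rightarrow> ereal" where
  "H2_opnorm T =
     (INF M \<in> {M. 0 \<le> M \<and> (\<forall>f\<in>H2. T f \<in> H2 \<and> H2_norm (T f) \<le> M * H2_norm f)}. ereal M)"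

text \<open>A linear map is compact if the image of the unit ball is relatively (sequentially) compact.\<close>

definition H2_compact :: "('h::complex_hilbert, 'n::finite) H2_op \<Rightarrow> bool" where
  "H2_compact T \<longleftrightarrow> H2_linear T \<and>
     (\<forall>s. (\<forall>k::nat. s k \<in> H2 \<and> H2_norm (s k) \<le> 1) \<longrightarrow>
        (\<exists>g\<in>H2. \<exists>r::nat \<Rightarrow> nat. strict_mono r \<and>
           (\<lambda>k. H2_norm (\<lambda>X. T (s (r k)) X - g X)) \<longlonglongrightarrow> 0))"

definition H2_ess_norm :: "('h::complex_hilbert, 'n::finite) H2_op \<Rightarrow> ereal" where
  "H2_ess_norm T = (INF K \<in> {K. H2_compact K}. H2_opnorm (\<lambda>f X. T f X - K f X))"

text \<open>
  Since \<open>f Y\<close> is the sum of the series of \<open>f\<close> at every \<open>Y\<close> in the ball, \<open>f (\<phi> X)\<close> is the sum over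
  \<open>k\<close> of the homogeneous parts of \<open>f\<close> evaluated at \<open>\<phi> X\<close>.
\<close>

definition comp_op ::
  "(('h::complex_hilbert, 'n::finite) tuple \<Rightarrow> ('h, 'n) tuple) \<Rightarrow> ('h, 'n) H2_op" where
  "comp_op \<phi> f = (\<lambda>X. if X \<in> nc_ball then f (\<phi> X) else 0)"

section \<open>Scalar representation and angular derivatives\<close>

text \<open>The Euclidean unit ball of complex \<open>n\<close>-space is \<open>ball 0 1\<close> in the type \<open>complex^'n\<close>.\<close>

definition scalar_tuple :: "complex^'n::finite \<Rightarrow> ('h::complex_hilbert, 'n) tuple" where
  "scalar_tuple z = (\<chi> i. cscale_op (z $ i) id_blinfun)"

definition scalar_rep ::
  "(('h::complex_hilbert, 'n::finite) tuple \<Rightarrow> ('h, 'n) tuple) \<Rightarrow> complex^'n \<Rightarrow> complex^'n" where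
  "scalar_rep \<phi> z = (THE w. \<phi> (scalar_tuple z) = scalar_tuple w)"

definition finite_angular_derivative ::
  "(complex^'n::finite \<Rightarrow> complex^'n) \<Rightarrow> complex^'n \<Rightarrow> bool" where
  "finite_angular_derivative \<psi> \<xi> \<longleftrightarrow>
     Liminf (at \<xi> within ball 0 1) (\<lambda>z. ereal ((1 - norm (\<psi> z)) / (1 - norm z))) < \<infinity>"

end

theory Submission
  imports Defs
begin

text \<open>
  Test the operators on the normalised reproducing kernel \<open>f\<close> at \<open>w = \<phi>(z)\<close>: the value of \<open>C\<^sub>\<phi> f\<close> at
  the scalar point \<open>z\<close> is \<open>f(w) = 1 / sqrt (1 - \<bar>w\<bar>\<^sup>2)\<close>. Evaluation at \<open>z\<close>, multiplied by
  \<open>sqrt (1 - \<bar>z\<bar>\<^sup>2)\<close>, is a contraction that tends to 0 pointwise on the Hardy space as \<open>\<bar>z\<bar> \<rightarrow> 1\<close>,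
  hence uniformly on relatively compact sets. So a compact \<open>K\<close> contributes nothing in the limit, and
  \<open>\<parallel>C\<^sub>\<phi> - K\<parallel>\<close> is at least the limit superior of \<open>sqrt ((1 - \<bar>z\<bar>\<^sup>2) / (1 - \<bar>w\<bar>\<^sup>2))\<close>; the adjoint of \<open>C\<^sub>\<phi>\<close>
  does not enter. If \<open>C\<^sub>\<phi>\<close> is compact, this limit superior is 0, which makes the Julia-Caratheodory
  quotient tend to infinity at every boundary point.
\<close>

section \<open>Adjoints and row operators\<close>

instance complex_hilbert \<subseteq> banach ..

text \<open>The imaginary part of a complex number is minus the real part of its product with the
  imaginary unit, so the real form determines the complex one. This lets a real adjoint serve as the
  complex adjoint.\<close>

lemma Re_Im_cinner: "cinner x y = Complex (inner x y) (- inner (\<i> *\<^sub>C x) y)"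
  by (simp add: complex_eq_iff inner_eq_Re_cinner cinner_scaleC_left)

text \<open>The representing vector minimises \<open>J\<close>: the parallelogram law makes a
  minimising sequence Cauchy, and the first variation at the limit identifies \<open>g\<close> with
  the inner product.\<close>

lemma riesz_real:
  fixes g :: "'a :: {real_inner, complete_space} \<Rightarrow> real"
  assumes g: "bounded_linear g"
  obtains u where "\<And>x. g x = inner x u"
proof -
  interpret g: bounded_linear g by fact
  define J where "J x = (norm x)\<^sup>2 - 2 * g x" for x
  obtain B where B: "\<And>x. norm (g x) \<le> norm x * B"
    using g.bounded by blast
  have low: "- B\<^sup>2 \<le> J x" for x
  proof -
    have "0 \<le> (norm x - B)\<^sup>2" by simp
    moreover have "g x \<le> norm x * B" using B[of x] by simp
    ultimately show ?thesis
      by (simp add: J_def power2_eq_square algebra_simps)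
  qed
  define m where "m = Inf (range J)"
  have bdd: "bdd_below (range J)"
    by (rule bdd_belowI2[OF low])
  have m_le: "m \<le> J x" for x
    unfolding m_def by (rule cInf_lower[OF _ bdd]) simp
  have "\<exists>x. J x < m + 1 / (real n + 1)" for n
  proof -
    have "Inf (range J) < m + 1 / (real n + 1)" by (simp add: m_def)
    then show ?thesis
      by (subst (asm) cInf_less_iff[OF _ bdd]) auto
  qed
  then obtain x where x: "\<And>n. J (x n) < m + 1 / (real n + 1)"
    by metis
  \<comment> \<open>The linear terms cancel against the midpoint, so this is the parallelogram law.
    As \<open>J\<close> is at least \<open>m\<close> at the midpoint, two near-minimisers are
    close.\<close>
  have par: "(norm (a - b))\<^sup>2 = 2 * (J a + J b - 2 * J ((1/2) *\<^sub>R (a + b)))" for a b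
    by (simp add: J_def g.scaleR g.add power2_norm_eq_inner inner_simps inner_commute algebra_simps)
  have close: "(norm (x i - x j))\<^sup>2 \<le> 2 * (1 / (real i + 1) + 1 / (real j + 1))" for i j
    using x[of i] x[of j] m_le[of "(1/2) *\<^sub>R (x i + x j)"] unfolding par by simp
  have "Cauchy x"
  proof (rule CauchyI)
    fix e :: real assume e: "0 < e"
    obtain N where N: "1 / (real N + 1) < e\<^sup>2 / 4"
      using e nat_approx_posE[of "e\<^sup>2 / 4"] by (auto simp: add.commute)
    have "norm (x i - x j) < e" if "i \<ge> N" "j \<ge> N" for i j
    proof -
      have "1 / (real i + 1) \<le> 1 / (real N + 1)" "1 / (real j + 1) \<le> 1 / (real N + 1)"
        using that by (auto intro!: divide_left_mono)
      then have "(norm (x i - x j))\<^sup>2 < e\<^sup>2"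
        using close[of i j] N by simp
      then show ?thesis
        using e by (simp add: power_less_imp_less_base)
    qed
    then show "\<exists>M. \<forall>m\<ge>M. \<forall>n\<ge>M. norm (x m - x n) < e" by blast
  qed
  then obtain u where u: "x \<longlonglongrightarrow> u"
    using Cauchy_convergent convergent_def by blast
  have "(\<lambda>n. J (x n)) \<longlonglongrightarrow> J u"
    unfolding J_def by (intro tendsto_intros u g.tendsto)
  moreover have "(\<lambda>n. m + 1 / (real n + 1)) \<longlonglongrightarrow> m + 0"
    by (intro tendsto_intros) (use LIMSEQ_inverse_real_of_nat in \<open>simp add: inverse_eq_divide add.commute\<close>)
  ultimately have "J u \<le> m + 0"
    by (rule LIMSEQ_le) (use x in \<open>auto intro: less_imp_le\<close>)
  then have Ju: "J u \<le> J y" for y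
    using m_le[of y] by simp
  have "g y = inner y u" for y
  proof -
    define d where "d = inner y u - g y"
    have ineq: "0 \<le> 2 * t * d + t\<^sup>2 * (norm y)\<^sup>2" for t
    proof -
      have "(norm (u + t *\<^sub>R y))\<^sup>2 = (norm u)\<^sup>2 + 2 * t * inner y u + t\<^sup>2 * (norm y)\<^sup>2"
        unfolding power2_norm_eq_inner
        by (simp add: inner_simps inner_commute power2_eq_square algebra_simps)
      then show ?thesis
        using Ju[of "u + t *\<^sub>R y"] by (simp add: J_def d_def g.add g.scaleR algebra_simps)
    qed
    have "d = 0"
    proof (cases "norm y = 0")
      case True
      then show ?thesis by (simp add: d_def g.zero)
    next
      case False
      \<comment> \<open>This \<open>t\<close> minimises the quadratic in \<open>ineq\<close>; the
        minimum is negative unless \<open>d = 0\<close>.\<close>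
      have "0 \<le> 2 * (- d / (norm y)\<^sup>2) * d + (- d / (norm y)\<^sup>2)\<^sup>2 * (norm y)\<^sup>2"
        by (rule ineq)
      also have "\<dots> = - (d / norm y)\<^sup>2"
        using False by (simp add: field_simps power2_eq_square)
      finally show ?thesis using False by simp
    qed
    then show ?thesis by (simp add: d_def)
  qed
  then show ?thesis using that by blast
qed

lemma adjoint_real_exists:
  fixes T :: "'a :: {real_inner, complete_space} \<Rightarrow>\<^sub>L 'a"
  obtains S :: "'a \<Rightarrow>\<^sub>L 'a" where "\<And>x y. inner (T x) y = inner x (S y)"
proof -
  have "\<exists>u. \<forall>x. inner (T x) y = inner x u" for y
  proof -
    have "bounded_linear (\<lambda>x. inner (T x) y)"
      by (intro bounded_linear_intros)
    then show ?thesis using riesz_real by metis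
  qed
  then obtain s where s: "\<And>x y. inner (T x) y = inner x (s y)"
    by metis
  have "bounded_linear s"
  proof (rule bounded_linear_intro)
    show "s (a + b) = s a + s b" for a b
      by (rule vector_eq_ldot[THEN iffD1]) (simp add: inner_simps flip: s)
    show "s (r *\<^sub>R a) = r *\<^sub>R s a" for r a
      by (rule vector_eq_ldot[THEN iffD1]) (simp add: inner_simps flip: s)
    show "norm (s a) \<le> norm a * norm T" for a
    proof (cases "s a = 0")
      case False
      have "norm (s a) * norm (s a) = inner (T (s a)) a"
        by (simp add: s flip: power2_norm_eq_inner power2_eq_square)
      also have "\<dots> \<le> norm (T (s a)) * norm a"
        by (rule norm_cauchy_schwarz)
      also have "\<dots> \<le> norm T * norm (s a) * norm a"
        by (intro mult_right_mono norm_blinfun) simp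
      finally show ?thesis
        using False by (simp add: algebra_simps)
    qed simp
  qed
  then have "\<And>x y. inner (T x) y = inner x (Blinfun s y)"
    by (simp add: bounded_linear_Blinfun_apply s)
  then show ?thesis using that by blast
qed

text \<open>Complex linearity of \<open>T\<close> carries the real adjoint identity over to
  \<open>cinner\<close> through \<open>Re_Im_cinner\<close>. Uniqueness makes the definite
  description in \<open>adj_op\<close> denote.\<close>

lemma adj_op_eqI:
  fixes T S :: "'h::complex_hilbert \<Rightarrow>\<^sub>L 'h"
  assumes T: "T \<in> BH" and S: "\<And>x y. inner (T x) y = inner x (S y)"
  shows "adj_op T = S"
  unfolding adj_op_def
proof (rule the_equality)
  have lin: "T (c *\<^sub>C x) = c *\<^sub>C T x" for c x
    using T by (simp add: BH_def)
  show "\<forall>x y. cinner (T x) y = cinner x (S y)"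
    by (simp add: Re_Im_cinner S flip: lin)
next
  fix S' :: "'h \<Rightarrow>\<^sub>L 'h" assume "\<forall>x y. cinner (T x) y = cinner x (S' y)"
  then have "inner x (S' y) = inner x (S y)" for x y
    by (metis S inner_eq_Re_cinner)
  then show "S' = S"
    by (intro blinfun_eqI) (metis vector_eq_ldot)
qed

lemma inner_adj_op:
  assumes "T \<in> BH"
  shows "inner (T x) y = inner x (adj_op T y)"
  by (metis adjoint_real_exists adj_op_eqI assms)

section \<open>Complex scalar multiples of operators\<close>

lemma cscale_op_apply [simp]: "cscale_op c T x = c *\<^sub>C T x"
  by transfer simp

lemma cinner_self: "cinner x x = complex_of_real ((norm x)\<^sup>2)"
  using arg_cong[OF cinner_commute[of x x], of Im]
  by (simp add: complex_eq_iff power2_norm_eq_inner inner_eq_Re_cinner)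

lemma norm_cscale_op: "norm (cscale_op c T) = cmod c * norm T"
proof (rule antisym)
  have le: "norm (cscale_op c T) \<le> cmod c * norm T" for c and T :: "'a \<Rightarrow>\<^sub>L 'a"
    by (rule norm_blinfun_bound) (auto simp: norm_scaleC mult.assoc intro!: mult_left_mono norm_blinfun)
  show "norm (cscale_op c T) \<le> cmod c * norm T" by (rule le)
  show "cmod c * norm T \<le> norm (cscale_op c T)"
  proof (cases "c = 0")
    case False
    \<comment> \<open>The reverse inequality is \<open>le\<close> applied to the inverse
      scalar.\<close>
    have "T = cscale_op (1 / c) (cscale_op c T)"
      using False by (intro blinfun_eqI) (simp add: scaleC_scaleC scaleC_one)
    then have "norm T \<le> cmod (1 / c) * norm (cscale_op c T)"
      using le by metis
    then show ?thesis
      using False by (simp add: norm_divide field_simps)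
  qed simp
qed

lemma cscale_op_add_left: "cscale_op (c + d) T = cscale_op c T + cscale_op d T"
  by (intro blinfun_eqI) (simp add: scaleC_add_left blinfun.add_left)

lemma cscale_op_add_right: "cscale_op c (S + T) = cscale_op c S + cscale_op c T"
  by (intro blinfun_eqI) (simp add: scaleC_add_right blinfun.add_left)

lemma cscale_op_cscale_op: "cscale_op c (cscale_op d T) = cscale_op (c * d) T"
  by (intro blinfun_eqI) (simp add: scaleC_scaleC)

lemma bounded_linear_cscale_op_left: "bounded_linear (\<lambda>c. cscale_op c T)"
  by (rule bounded_linear_intro[where K = "norm T"])
    (auto simp: cscale_op_add_left norm_cscale_op scaleR_conv_of_real
      intro!: blinfun_eqI simp: scaleC_scaleC scaleR_eq_scaleC blinfun.scaleR_left)

lemma bounded_linear_cscale_op_right: "bounded_linear (cscale_op c)"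
  by (rule bounded_linear_intro[where K = "cmod c"])
    (auto simp: cscale_op_add_right norm_cscale_op mult.commute
      intro!: blinfun_eqI simp: scaleC_scaleC scaleR_eq_scaleC blinfun.scaleR_left)

lemmas cscale_op_sum_left = linear_sum[OF bounded_linear.linear[OF bounded_linear_cscale_op_left]]
  and cscale_op_sum_right = linear_sum[OF bounded_linear.linear[OF bounded_linear_cscale_op_right]]
  and cscale_op_diff_left = linear_diff[OF bounded_linear.linear[OF bounded_linear_cscale_op_left]]

lemma cscale_op_zero_left [simp]: "cscale_op 0 T = 0"
  using norm_cscale_op[of 0 T] by simp

lemma cscale_op_in_BH: "T \<in> BH \<Longrightarrow> cscale_op c T \<in> BH"
  by (simp add: BH_def scaleC_scaleC mult.commute)

lemma id_in_BH: "id_blinfun \<in> BH"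
  by (simp add: BH_def)

text \<open>The combination is the row operator of \<open>X\<close> composed with the column of
  scalars \<open>c $ i\<close>, and the square root is the norm of the row. Without forming the row,
  the proof tests \<open>y = ?T x\<close> against itself, moves each \<open>X $ i\<close> to its
  adjoint and uses Cauchy-Schwarz over \<open>i\<close>.\<close>

lemma norm_row_operator_le:
  fixes X :: "('h::complex_hilbert, 'n::finite) tuple" and c :: "complex^'n"
  assumes X: "\<And>i. X $ i \<in> BH"
  shows "norm (\<Sum>i\<in>UNIV. cscale_op (c $ i) (X $ i))
    \<le> norm c * sqrt (norm (\<Sum>i\<in>UNIV. X $ i o\<^sub>L adj_op (X $ i)))"
proof (rule norm_blinfun_bound)
  let ?R = "\<Sum>i\<in>UNIV. X $ i o\<^sub>L adj_op (X $ i)"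
  let ?T = "\<Sum>i\<in>UNIV. cscale_op (c $ i) (X $ i)"
  show "0 \<le> norm c * sqrt (norm ?R)" by simp
  fix x
  define y where "y = ?T x"
  define A where "A i = adj_op (X $ i)" for i
  have "(\<Sum>i\<in>UNIV. (norm (A i y))\<^sup>2) = inner (?R y) y"
    by (simp add: A_def blinfun.sum_left inner_sum_left inner_adj_op[OF X] power2_norm_eq_inner)
  also have "\<dots> \<le> norm (?R y) * norm y"
    by (rule norm_cauchy_schwarz)
  also have "\<dots> \<le> norm ?R * norm y * norm y"
    by (intro mult_right_mono norm_blinfun) simp
  finally have A: "L2_set (\<lambda>i. norm (A i y)) UNIV \<le> sqrt (norm ?R) * norm y"
    by (auto simp: L2_set_def real_sqrt_mult mult.assoc dest: real_sqrt_le_mono)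
  have "(norm y)\<^sup>2 = inner (?T x) y"
    by (simp add: y_def power2_norm_eq_inner)
  also have "\<dots> = (\<Sum>i\<in>UNIV. inner (blinfun_apply (X $ i) (c $ i *\<^sub>C x)) y)"
    using X by (simp add: blinfun.sum_left inner_sum_left BH_def)
  also have "\<dots> \<le> (\<Sum>i\<in>UNIV. norm x * (cmod (c $ i) * norm (A i y)))"
  proof (rule sum_mono)
    fix i
    have "inner (blinfun_apply (X $ i) (c $ i *\<^sub>C x)) y = inner (c $ i *\<^sub>C x) (A i y)"
      by (simp add: A_def inner_adj_op[OF X])
    also have "\<dots> \<le> norm (c $ i *\<^sub>C x) * norm (A i y)"
      by (rule norm_cauchy_schwarz)
    finally show "inner (blinfun_apply (X $ i) (c $ i *\<^sub>C x)) y \<le> norm x * (cmod (c $ i) * norm (A i y))"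
      by (simp add: norm_scaleC mult_ac)
  qed
  also have "\<dots> = norm x * (\<Sum>i\<in>UNIV. \<bar>cmod (c $ i)\<bar> * \<bar>norm (A i y)\<bar>)"
    by (simp add: sum_distrib_left)
  also have "\<dots> \<le> norm x * (L2_set (\<lambda>i. cmod (c $ i)) UNIV * L2_set (\<lambda>i. norm (A i y)) UNIV)"
    by (intro mult_left_mono L2_set_mult_ineq) simp
  also have "\<dots> \<le> norm x * (norm c * (sqrt (norm ?R) * norm y))"
    unfolding norm_vec_def by (intro mult_left_mono A L2_set_nonneg norm_ge_zero)
  finally have "norm y * norm y \<le> (norm c * sqrt (norm ?R) * norm x) * norm y"
    by (simp add: power2_eq_square mult_ac)
  then have "norm y \<le> norm c * sqrt (norm ?R) * norm x"
    by (cases "y = 0") auto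
  then show "norm (?T x) \<le> norm c * sqrt (norm ?R) * norm x"
    by (simp add: y_def)
qed

lemma scaleR_in_BH: "T \<in> BH \<Longrightarrow> r *\<^sub>R T \<in> BH"
  by (simp add: BH_def blinfun.scaleR_left scaleR_eq_scaleC scaleC_scaleC mult.commute)

lemma adj_op_scaleR:
  assumes "T \<in> BH"
  shows "adj_op (r *\<^sub>R T) = r *\<^sub>R adj_op T"
  using assms
  by (intro adj_op_eqI) (simp_all add: scaleR_in_BH blinfun.scaleR_left inner_adj_op)

lemma scaled_tuple_in_nc_ball:
  fixes X :: "('h::complex_hilbert, 'n::finite) tuple"
  assumes X: "\<And>i. X $ i \<in> BH"
  obtains t where "t > 0" "t *\<^sub>R X \<in> nc_ball"
proof
  let ?R = "\<Sum>i\<in>UNIV. X $ i o\<^sub>L adj_op (X $ i)"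
  \<comment> \<open>The summand 1 keeps \<open>t\<close> meaningful when \<open>?R\<close> is 0 and
    makes \<open>(1 + norm ?R)\<^sup>2\<close> exceed \<open>norm ?R\<close>; the ball condition
    scales with \<open>t\<^sup>2\<close>.\<close>
  define t where "t = 1 / (1 + norm ?R)"
  show "t > 0" by (simp add: t_def add_pos_nonneg)
  have "t *\<^sub>R X $ i o\<^sub>L adj_op (t *\<^sub>R X $ i) = t\<^sup>2 *\<^sub>R (X $ i o\<^sub>L adj_op (X $ i))" for i
    by (intro blinfun_eqI)
      (simp add: adj_op_scaleR[OF X] blinfun.scaleR_left blinfun.scaleR_right power2_eq_square)
  then have "(\<Sum>i\<in>UNIV. (t *\<^sub>R X) $ i o\<^sub>L adj_op ((t *\<^sub>R X) $ i)) = t\<^sup>2 *\<^sub>R ?R"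
    by (simp add: scaleR_sum_right)
  moreover have "t\<^sup>2 * norm ?R < 1"
  proof -
    have "norm ?R < (1 + norm ?R)\<^sup>2"
      using norm_ge_zero[of ?R] by (simp add: power2_eq_square algebra_simps add_pos_nonneg)
    moreover have "0 < (1 + norm ?R)\<^sup>2"
      using norm_ge_zero[of ?R] by (intro zero_less_power) linarith
    ultimately show ?thesis
      by (simp add: t_def power_divide)
  qed
  moreover have "(t *\<^sub>R X) $ i \<in> BH" for i
    using X[of i] by (simp add: scaleR_in_BH)
  ultimately show "t *\<^sub>R X \<in> nc_ball"
    by (simp add: nc_ball_def)
qed

section \<open>Uniqueness of coefficients\<close>

lemma cinner_scaleC_right: "cinner x (c *\<^sub>C y) = cnj c * cinner x y"
  by (metis cinner_scaleC_left cinner_commute complex_cnj_mult)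

lemma bounded_linear_cinner_left: "bounded_linear (\<lambda>x. cinner x e)"
proof (rule bounded_linear_intro)
  show "norm (cinner x e) \<le> norm x * (norm e + norm e)" for x
  proof -
    have "norm (cinner x e) \<le> \<bar>inner x e\<bar> + \<bar>inner (\<i> *\<^sub>C x) e\<bar>"
      unfolding Re_Im_cinner[of x] by (rule order_trans[OF cmod_le]) simp
    also have "\<dots> \<le> norm x * norm e + norm (\<i> *\<^sub>C x) * norm e"
      by (intro add_mono Cauchy_Schwarz_ineq2)
    finally show ?thesis by (simp add: norm_scaleC algebra_simps)
  qed
qed (simp_all add: cinner_add_left scaleR_eq_scaleC cinner_scaleC_left scaleR_conv_of_real)

lemmas cinner_sum_left = linear_sum[OF bounded_linear.linear[OF bounded_linear_cinner_left]]

text \<open>Gram-Schmidt: a finite family never spans, so some vector leaves a nonzero remainder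
  after projection, which is then normalised.\<close>

lemma orthonormal_family_exists:
  assumes "\<not> (\<exists>B :: 'h::complex_hilbert set. finite B \<and> cspan B = UNIV)"
  shows "\<exists>e :: nat \<Rightarrow> 'h. \<forall>i<m. \<forall>j<m. cinner (e i) (e j) = (if i = j then 1 else 0)"
proof (induction m)
  case (Suc m)
  then obtain e :: "nat \<Rightarrow> 'h"
    where e: "\<And>i j. i < m \<Longrightarrow> j < m \<Longrightarrow> cinner (e i) (e j) = (if i = j then 1 else 0)"
    by blast
  obtain x where x: "x \<notin> cspan (e ` {..<m})"
    using assms by (metis UNIV_eq_I finite_imageI finite_lessThan)
  define p where "p = (\<Sum>i<m. cinner x (e i) *\<^sub>C e i)"
  define v where "v = x - p"
  have "p \<in> cspan (e ` {..<m})"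
    unfolding p_def
    by (intro complex_vector.span_sum complex_vector.span_scale complex_vector.span_base) auto
  then have "v \<noteq> 0" using x by (auto simp: v_def)
  have orth: "cinner v (e j) = 0" if "j < m" for j
  proof -
    have "cinner p (e j) = (\<Sum>i<m. if i = j then cinner x (e j) else 0)"
      unfolding p_def cinner_sum_left
      by (intro sum.cong) (auto simp: cinner_scaleC_left e that)
    moreover have "cinner x (e j) = cinner v (e j) + cinner p (e j)"
      by (simp add: v_def flip: cinner_add_left)
    ultimately show ?thesis using that by simp
  qed
  define u where "u = complex_of_real (1 / norm v) *\<^sub>C v"
  have "cinner u u = 1"
    using \<open>v \<noteq> 0\<close> by (simp add: cinner_self u_def norm_scaleC norm_divide)
  moreover have "cinner u (e j) = 0" "cinner (e j) u = 0" if "j < m" for j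
    using orth[OF that] cinner_commute[of "e j" v]
    by (simp_all add: u_def cinner_scaleC_left cinner_scaleC_right)
  ultimately have "\<forall>i<Suc m. \<forall>j<Suc m. cinner ((e(m := u)) i) ((e(m := u)) j) = (if i = j then 1 else 0)"
    using e by (auto simp: less_Suc_eq)
  then show ?case by blast
qed simp

text \<open>
  Word by word, the shift tuple of \<open>\<beta>\<close> moves the orthonormal vectors \<open>e\<^sub>k, \<dots>, e\<^sub>0\<close> one step down,
  the step from \<open>e\<^sub>j\<^sub>+\<^sub>1\<close> being made by the generator at position \<open>j\<close> of \<open>\<beta>\<close>. So only the word \<open>\<beta>\<close> itself
  leads from \<open>e\<^sub>k\<close> to \<open>e\<^sub>0\<close>, which isolates the coefficient at \<open>\<beta>\<close>.
\<close>

lemma separating_tuple_exists: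
  fixes \<beta> :: "'n::finite list"
  assumes inf: "\<not> (\<exists>B :: 'h::complex_hilbert set. finite B \<and> cspan B = UNIV)"
  obtains X :: "('h::complex_hilbert, 'n) tuple" and x y :: "'h::complex_hilbert" and c where "X \<in> nc_ball" "c \<noteq> 0"
    "\<And>\<alpha>. cinner (word_op X \<alpha> x) y = (if \<alpha> = \<beta> then c else 0)"
proof -
  define k where "k = length \<beta>"
  obtain e :: "nat \<Rightarrow> 'h"
    where e: "\<And>i j. i \<le> k \<Longrightarrow> j \<le> k \<Longrightarrow> cinner (e i) (e j) = (if i = j then 1 else 0)"
    using orthonormal_family_exists[OF inf, of "Suc k"] by (auto simp: less_Suc_eq_le)
  define s where "s i x = (\<Sum>j | j < k \<and> \<beta> ! j = i. cinner x (e (Suc j)) *\<^sub>C e j)" for i x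
  have bl: "bounded_linear (s i)" for i
    unfolding s_def
  proof (intro bounded_linear_sum)
    fix j
    have "bounded_linear (\<lambda>c. c *\<^sub>C e j)"
      by (rule bounded_linear_intro[where K = "norm (e j)"])
        (simp_all add: scaleC_add_left norm_scaleC scaleR_eq_scaleC scaleC_scaleC scaleR_conv_of_real)
    then show "bounded_linear (\<lambda>x. cinner x (e (Suc j)) *\<^sub>C e j)"
      by (rule bounded_linear_compose[OF _ bounded_linear_cinner_left])
  qed
  define X0 :: "('h, 'n) tuple" where "X0 = (\<chi> i. Blinfun (s i))"
  have X0: "blinfun_apply (X0 $ i) = s i" for i
    by (simp add: X0_def bounded_linear_Blinfun_apply bl)
  have "X0 $ i \<in> BH" for i
    by (simp add: BH_def X0 s_def cinner_scaleC_left complex_vector.scale_sum_right scaleC_scaleC)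
  then obtain t where t: "t > 0" "t *\<^sub>R X0 \<in> nc_ball"
    by (rule scaled_tuple_in_nc_ball)
  define X where "X = t *\<^sub>R X0"
  \<comment> \<open>Orthonormality leaves only the summand \<open>l = j\<close>. For
    \<open>j = k\<close> there is none, since the shift never produces \<open>e k\<close>.\<close>
  have step: "cinner (blinfun_apply (X $ i) x) (e j) =
      (if j < k \<and> \<beta> ! j = i then complex_of_real t * cinner x (e (Suc j)) else 0)" if "j \<le> k" for i j x
  proof -
    have "cinner (s i x) (e j) = (\<Sum>l | l < k \<and> \<beta> ! l = i. if l = j then cinner x (e (Suc j)) else 0)"
      unfolding s_def cinner_sum_left
      using that by (intro sum.cong) (auto simp: cinner_scaleC_left e)
    then show ?thesis
      by (simp add: X_def blinfun.scaleR_left X0 scaleR_eq_scaleC cinner_scaleC_left)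
  qed
  \<comment> \<open>The first letter of a word acts last, so testing against \<open>e j\<close>
    reads the word from its front along \<open>\<beta>\<close>, starting at position
    \<open>j\<close>. Hence the induction is over all \<open>j\<close>.\<close>
  have word: "cinner (word_op X \<alpha> x) (e j) =
      (if j + length \<alpha> \<le> k \<and> take (length \<alpha>) (drop j \<beta>) = \<alpha>
       then complex_of_real t ^ length \<alpha> * cinner x (e (j + length \<alpha>)) else 0)" if "j \<le> k" for \<alpha> j x
    using that
  proof (induction \<alpha> arbitrary: j)
    case (Cons i \<alpha>)
    show ?case
    proof (cases "j < k")
      case True
      then have "drop j \<beta> = \<beta> ! j # drop (Suc j) \<beta>"
        by (simp add: k_def Cons_nth_drop_Suc)
      then show ?thesis
        using True Cons.IH[of "Suc j"] Cons.prems by (auto simp: step)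
    next
      case False
      then show ?thesis using Cons.prems by (simp add: step)
    qed
  qed simp
  \<comment> \<open>Orthonormality against \<open>e k\<close> forces
    \<open>length \<alpha> = k\<close>, so the matching segment is all of
    \<open>\<beta>\<close>.\<close>
  have "cinner (word_op X \<alpha> (e k)) (e 0) = (if \<alpha> = \<beta> then complex_of_real t ^ k else 0)" for \<alpha>
    using word[of 0 \<alpha> "e k"] by (auto simp: e k_def)
  moreover have "X \<in> nc_ball" "complex_of_real t ^ k \<noteq> 0"
    using t by (simp_all add: X_def)
  ultimately show ?thesis
    using that by blast
qed

section \<open>Homogeneous parts and the coefficients they determine\<close>

definition hom_part :: "('n list \<Rightarrow> complex) \<Rightarrow> ('h::complex_hilbert, 'n::finite) tuple \<Rightarrow> nat \<Rightarrow> ('h \<Rightarrow>\<^sub>L 'h)"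
  where "hom_part a X k = (\<Sum>\<alpha> | length \<alpha> = k. cscale_op (a \<alpha>) (word_op X \<alpha>))"

lemma has_free_series_sums:
  "has_free_series f a \<Longrightarrow> X \<in> nc_ball \<Longrightarrow> hom_part a X sums f X"
  by (simp add: has_free_series_def hom_part_def[abs_def])

lemma finite_words [simp]: "finite {\<alpha> :: 'n::finite list. length \<alpha> = k}"
  using finite_lists_length_eq[of "UNIV :: 'n set" k] by simp

text \<open>A matrix entry at the separating tuple is a norm continuous functional, so it passes
  through the series and leaves only the term of \<open>\<beta>\<close>.\<close>

lemma free_series_unique:
  fixes f :: "('h::complex_hilbert, 'n::finite) tuple \<Rightarrow> ('h \<Rightarrow>\<^sub>L 'h)"
  assumes inf: "\<not> (\<exists>B :: 'h set. finite B \<and> cspan B = UNIV)"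
    and a: "has_free_series f a" and b: "has_free_series f b"
  shows "a = b"
proof
  fix \<beta>
  obtain X :: "('h, 'n) tuple" and x y c where X: "X \<in> nc_ball" "c \<noteq> 0"
    "\<And>\<alpha>. cinner (word_op X \<alpha> x) y = (if \<alpha> = \<beta> then c else 0)"
    by (rule separating_tuple_exists[OF inf, where \<beta> = \<beta>]) (rule that; assumption)
  have coeff: "cinner (f X x) y = a \<beta> * c" if "has_free_series f a" for a
  proof -
    have "(\<lambda>k. cinner (hom_part a X k x) y) sums cinner (f X x) y"
      by (rule bounded_linear.sums[OF bounded_linear_cinner_left])
        (rule bounded_linear.sums[OF blinfun.bounded_linear_left has_free_series_sums[OF that X(1)]])
    moreover have "cinner (hom_part a X k x) y = (if k = length \<beta> then a \<beta> * c else 0)" for k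
    proof -
      have "cinner (hom_part a X k x) y = (\<Sum>\<alpha> | length \<alpha> = k. if \<alpha> = \<beta> then a \<beta> * c else 0)"
        unfolding hom_part_def blinfun.sum_left cinner_sum_left
        by (intro sum.cong) (auto simp: cinner_scaleC_left X)
      then show ?thesis by auto
    qed
    ultimately have "(\<lambda>k. if k = length \<beta> then a \<beta> * c else 0) sums cinner (f X x) y"
      by simp
    then show ?thesis
      using sums_single[of "length \<beta>" "\<lambda>_. a \<beta> * c"] sums_unique2 by blast
  qed
  show "a \<beta> = b \<beta>"
    using coeff[OF a] coeff[OF b] X(2) by simp
qed

lemma free_coeff_eqI:
  fixes f :: "('h::complex_hilbert, 'n::finite) tuple \<Rightarrow> ('h \<Rightarrow>\<^sub>L 'h)"
  assumes "\<not> (\<exists>B :: 'h set. finite B \<and> cspan B = UNIV)" "has_free_series f a"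
  shows "free_coeff f = a"
  unfolding free_coeff_def
  using assms free_series_unique by blast

lemma has_free_series_coeff:
  fixes f :: "('h::complex_hilbert, 'n::finite) tuple \<Rightarrow> ('h \<Rightarrow>\<^sub>L 'h)"
  assumes "\<not> (\<exists>B :: 'h set. finite B \<and> cspan B = UNIV)" "free_holomorphic f"
  shows "has_free_series f (free_coeff f)"
  using assms free_coeff_eqI unfolding free_holomorphic_def by metis

section \<open>Membership in the Hardy space\<close>

text \<open>Square summability bounds all degrees by one constant, whose roots tend to 1. So the
  growth condition of a free series is automatic in the Hardy space.\<close>

lemma limsup_words_le_1:
  fixes a :: "'n::finite list \<Rightarrow> complex"
  assumes a: "(\<lambda>\<alpha>. (cmod (a \<alpha>))\<^sup>2) summable_on UNIV"
  shows "limsup (\<lambda>k. ereal ((\<Sum>\<alpha> | length \<alpha> = k. (cmod (a \<alpha>))\<^sup>2) powr (1 / (2 * real k)))) \<le> 1"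
proof -
  \<comment> \<open>The added 1 gives a positive base for the limit of powers even when all
    coefficients vanish.\<close>
  define C where "C = 1 + (\<Sum>\<^sub>\<infinity>\<alpha>. (cmod (a \<alpha>))\<^sup>2)"
  have "C \<ge> 1" by (simp add: C_def infsum_nonneg)
  have le: "(\<Sum>\<alpha> | length \<alpha> = k. (cmod (a \<alpha>))\<^sup>2) \<le> C" for k
    using finite_sum_le_infsum[OF a, of "{\<alpha>. length \<alpha> = k}"] by (simp add: C_def)
  have "(\<lambda>k. 1 / (2 * real k)) \<longlonglongrightarrow> 0"
    using tendsto_mult_left[OF lim_1_over_n, of "1/2"] by (simp add: mult.commute)
  then have "(\<lambda>k. C powr (1 / (2 * real k))) \<longlonglongrightarrow> C powr 0"
    using \<open>C \<ge> 1\<close> by (intro tendsto_intros) auto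
  then have lim: "(\<lambda>k. ereal (C powr (1 / (2 * real k)))) \<longlonglongrightarrow> 1"
    using \<open>C \<ge> 1\<close> by (simp add: one_ereal_def)
  have "limsup (\<lambda>k. ereal ((\<Sum>\<alpha> | length \<alpha> = k. (cmod (a \<alpha>))\<^sup>2) powr (1 / (2 * real k))))
      \<le> limsup (\<lambda>k. ereal (C powr (1 / (2 * real k))))"
    by (intro Limsup_mono always_eventually allI)
      (simp add: powr_mono2 le sum_nonneg)
  also have "\<dots> = 1"
    using lim_imp_Limsup[OF _ lim] by simp
  finally show ?thesis .
qed

text \<open>For square summable coefficients only convergence on the ball remains to be checked.
  Identifying the coefficients also makes \<open>H2_norm\<close> computable.\<close>

lemma H2_intro:
  fixes f :: "('h::complex_hilbert, 'n::finite) tuple \<Rightarrow> ('h \<Rightarrow>\<^sub>L 'h)"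
  assumes inf: "\<not> (\<exists>B :: 'h set. finite B \<and> cspan B = UNIV)"
    and a: "(\<lambda>\<alpha>. (cmod (a \<alpha>))\<^sup>2) summable_on UNIV"
    and sums: "\<And>X. X \<in> nc_ball \<Longrightarrow> hom_part a X sums f X"
    and off: "\<And>X. X \<notin> nc_ball \<Longrightarrow> f X = 0"
  shows "f \<in> H2" "free_coeff f = a"
proof -
  have f: "has_free_series f a"
    using limsup_words_le_1[OF a] sums by (simp add: has_free_series_def hom_part_def[abs_def])
  then show "free_coeff f = a"
    by (rule free_coeff_eqI[OF inf])
  then show "f \<in> H2"
    using f a off by (auto simp: H2_def free_holomorphic_def)
qed

lemma H2_zero:
  assumes inf: "\<not> (\<exists>B :: 'h::complex_hilbert set. finite B \<and> cspan B = UNIV)"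
  shows "(\<lambda>X :: ('h, 'n::finite) tuple. 0) \<in> H2" "H2_norm (\<lambda>X :: ('h, 'n) tuple. 0) = 0"
proof -
  have *: "(\<lambda>\<alpha> :: 'n list. (cmod 0)\<^sup>2) summable_on UNIV"
    "\<And>X :: ('h, 'n) tuple. hom_part (\<lambda>_. 0) X sums 0"
    by (simp_all add: hom_part_def[abs_def])
  note H2_intro[OF inf *]
  then show "(\<lambda>X :: ('h, 'n) tuple. 0) \<in> H2" "H2_norm (\<lambda>X :: ('h, 'n) tuple. 0) = 0"
    by (simp_all add: H2_norm_def)
qed

text \<open>Needed to apply point evaluation bounds to \<open>K f - g\<close>: those bounds require
  a member of \<open>H2\<close>.\<close>

lemma H2_diff:
  fixes f g :: "('h::complex_hilbert, 'n::finite) tuple \<Rightarrow> ('h \<Rightarrow>\<^sub>L 'h)"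
  assumes inf: "\<not> (\<exists>B :: 'h set. finite B \<and> cspan B = UNIV)"
    and f: "f \<in> H2" and g: "g \<in> H2"
  shows "(\<lambda>X. f X - g X) \<in> H2"
proof (rule H2_intro(1)[OF inf])
  let ?a = "free_coeff f" and ?b = "free_coeff g"
  have sa: "(\<lambda>\<alpha>. (cmod (?a \<alpha>))\<^sup>2) summable_on UNIV" and sb: "(\<lambda>\<alpha>. (cmod (?b \<alpha>))\<^sup>2) summable_on UNIV"
    using f g by (auto simp: H2_def)
  have "(\<lambda>\<alpha>. 2 * (cmod (?a \<alpha>))\<^sup>2 + 2 * (cmod (?b \<alpha>))\<^sup>2) summable_on UNIV"
    by (intro summable_on_add summable_on_cmult_right sa sb)
  then show "(\<lambda>\<alpha>. (cmod (?a \<alpha> - ?b \<alpha>))\<^sup>2) summable_on UNIV"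
  proof (rule summable_on_comparison_test)
    fix \<alpha>
    have "(cmod (?a \<alpha> - ?b \<alpha>))\<^sup>2 \<le> (cmod (?a \<alpha>) + cmod (?b \<alpha>))\<^sup>2"
      by (intro power_mono norm_triangle_ineq4) simp
    also have "\<dots> \<le> 2 * (cmod (?a \<alpha>))\<^sup>2 + 2 * (cmod (?b \<alpha>))\<^sup>2"
      using zero_le_power2[of "cmod (?a \<alpha>) - cmod (?b \<alpha>)"]
      by (simp add: power2_eq_square algebra_simps)
    finally show "(cmod (?a \<alpha> - ?b \<alpha>))\<^sup>2 \<le> 2 * (cmod (?a \<alpha>))\<^sup>2 + 2 * (cmod (?b \<alpha>))\<^sup>2" .
  qed simp
  have "has_free_series f ?a" "has_free_series g ?b"
    using f g has_free_series_coeff[OF inf] by (auto simp: H2_def)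
  then have "(\<lambda>k. hom_part ?a X k - hom_part ?b X k) sums (f X - g X)" if "X \<in> nc_ball" for X
    by (intro sums_diff has_free_series_sums that)
  then show "hom_part (\<lambda>\<alpha>. ?a \<alpha> - ?b \<alpha>) X sums (f X - g X)" if "X \<in> nc_ball" for X
    using that by (simp add: hom_part_def[abs_def] cscale_op_diff_left sum_subtractf)
  show "f X - g X = 0" if "X \<notin> nc_ball" for X
    using that f g by (simp add: H2_def)
qed

section \<open>Values at scalar points\<close>

definition zword :: "complex^'n \<Rightarrow> 'n list \<Rightarrow> complex"
  where "zword z \<alpha> = prod_list (map (($) z) \<alpha>)"

lemma zword_simps [simp]: "zword z [] = 1" "zword z (i # \<alpha>) = z $ i * zword z \<alpha>"
  by (simp_all add: zword_def)

section \<open>Sums over words of fixed length\<close>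

lemma sum_words_Suc:
  fixes F :: "'n::finite list \<Rightarrow> 'b::comm_monoid_add"
  shows "(\<Sum>\<alpha> | length \<alpha> = Suc k. F \<alpha>) = (\<Sum>i\<in>UNIV. \<Sum>\<alpha> | length \<alpha> = k. F (i # \<alpha>))"
proof -
  have "(\<Sum>i\<in>UNIV. \<Sum>\<alpha> | length \<alpha> = k. F (i # \<alpha>)) =
      (\<Sum>(i, \<alpha>)\<in>UNIV \<times> {\<alpha>. length \<alpha> = k}. F (i # \<alpha>))"
    by (rule sum.cartesian_product)
  also have "\<dots> = (\<Sum>\<alpha> | length \<alpha> = Suc k. F \<alpha>)"
    by (rule sum.reindex_bij_witness[of _ "\<lambda>\<alpha>. (hd \<alpha>, tl \<alpha>)" "\<lambda>(i, \<alpha>). i # \<alpha>"])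
      (auto simp: length_Suc_conv)
  finally show ?thesis ..
qed

text \<open>Expanding the power without collecting equal monomials gives one term per word. It is
  used for the squared moduli of coordinates and for the pairing in the kernel.\<close>

lemma sum_words_prod_list:
  fixes g :: "'n::finite \<Rightarrow> 'b::comm_semiring_1"
  shows "(\<Sum>\<alpha> | length \<alpha> = k. prod_list (map g \<alpha>)) = (\<Sum>i\<in>UNIV. g i) ^ k"
proof (induction k)
  case (Suc k)
  have "(\<Sum>\<alpha> | length \<alpha> = Suc k. prod_list (map g \<alpha>)) =
      (\<Sum>i\<in>UNIV. g i * (\<Sum>\<alpha> | length \<alpha> = k. prod_list (map g \<alpha>)))"
    by (simp add: sum_words_Suc sum_distrib_left)
  then show ?case
    by (simp add: Suc sum_distrib_right)
qed simp

lemma norm_vec_power2: "(norm (z :: complex^'n::finite))\<^sup>2 = (\<Sum>i\<in>UNIV. (cmod (z $ i))\<^sup>2)"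
  by (simp add: norm_vec_def L2_set_def sum_nonneg)

lemma sum_zword_norm:
  fixes z :: "complex^'n::finite"
  shows "(\<Sum>\<alpha> | length \<alpha> = k. (cmod (zword z \<alpha>))\<^sup>2) = ((norm z)\<^sup>2) ^ k"
proof -
  have "(cmod (zword z \<alpha>))\<^sup>2 = prod_list (map (\<lambda>i. (cmod (z $ i))\<^sup>2) \<alpha>)" for \<alpha>
    by (induction \<alpha>) (simp_all add: norm_mult power_mult_distrib)
  then show ?thesis
    by (simp add: sum_words_prod_list norm_vec_power2)
qed

lemma sum_zword_mult:
  fixes v w :: "complex^'n::finite"
  shows "(\<Sum>\<alpha> | length \<alpha> = k. zword v \<alpha> * zword w \<alpha>) = (\<Sum>i\<in>UNIV. v $ i * w $ i) ^ k"
proof -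
  have "zword v \<alpha> * zword w \<alpha> = prod_list (map (\<lambda>i. v $ i * w $ i) \<alpha>)" for \<alpha>
    by (induction \<alpha>) (simp_all add: mult_ac)
  then show ?thesis
    by (simp add: sum_words_prod_list)
qed

section \<open>Scalar tuples and the scalar representation\<close>

lemma word_op_scalar_tuple: "word_op (scalar_tuple z) \<alpha> = cscale_op (zword z \<alpha>) id_blinfun"
  by (induction \<alpha>) (auto intro!: blinfun_eqI simp: scalar_tuple_def scaleC_scaleC scaleC_one)

lemma hom_part_scalar_tuple:
  "hom_part a (scalar_tuple z) k =
    cscale_op (\<Sum>\<alpha> | length \<alpha> = k. a \<alpha> * zword z \<alpha>) id_blinfun"
  by (simp add: hom_part_def word_op_scalar_tuple cscale_op_cscale_op cscale_op_sum_left)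

text \<open>Infinite dimension excludes the zero space, on which the identity has norm 0.\<close>

lemma norm_id_infinite_dim:
  assumes "\<not> (\<exists>B :: 'h::complex_hilbert set. finite B \<and> cspan B = UNIV)"
  shows "norm (id_blinfun :: 'h \<Rightarrow>\<^sub>L 'h) = 1"
proof -
  have "cspan {} \<noteq> (UNIV :: 'h set)"
    using assms finite.emptyI by blast
  then obtain x :: 'h where "x \<noteq> 0"
    by auto
  moreover have "norm x \<le> norm (id_blinfun :: 'h \<Rightarrow>\<^sub>L 'h) * norm x"
    using norm_blinfun[of id_blinfun x] by simp
  ultimately show ?thesis
    using norm_blinfun_id_le[where 'a = 'h] by simp
qed

lemma scalar_tuple_in_nc_ball_iff:
  assumes inf: "\<not> (\<exists>B :: 'h::complex_hilbert set. finite B \<and> cspan B = UNIV)"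
  shows "(scalar_tuple z :: ('h, 'n::finite) tuple) \<in> nc_ball \<longleftrightarrow> norm z < 1"
proof -
  have adj: "adj_op (cscale_op c id_blinfun :: 'h \<Rightarrow>\<^sub>L 'h) = cscale_op (cnj c) id_blinfun" for c
    by (intro adj_op_eqI cscale_op_in_BH id_in_BH)
      (simp add: inner_eq_Re_cinner cinner_scaleC_left cinner_scaleC_right)
  have "cscale_op c id_blinfun o\<^sub>L cscale_op (cnj c) id_blinfun =
      cscale_op (complex_of_real ((cmod c)\<^sup>2)) (id_blinfun :: 'h \<Rightarrow>\<^sub>L 'h)" for c
    by (intro blinfun_eqI) (simp add: scaleC_scaleC flip: complex_norm_square)
  then have "(\<Sum>i\<in>UNIV. (scalar_tuple z :: ('h, 'n) tuple) $ i o\<^sub>L adj_op ((scalar_tuple z :: ('h, 'n) tuple) $ i)) =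
      cscale_op (complex_of_real ((norm z)\<^sup>2)) id_blinfun"
    by (simp add: scalar_tuple_def adj norm_vec_power2 flip: cscale_op_sum_left)
  moreover have "norm (cscale_op (complex_of_real ((norm z)\<^sup>2)) (id_blinfun :: 'h \<Rightarrow>\<^sub>L 'h)) = (norm z)\<^sup>2"
    by (simp add: norm_cscale_op norm_id_infinite_dim[OF inf] del: of_real_power)
  ultimately show ?thesis
    by (simp add: nc_ball_def cscale_op_in_BH id_in_BH scalar_tuple_def abs_square_less_1)
qed

lemma scalar_tuple_inject:
  assumes inf: "\<not> (\<exists>B :: 'h::complex_hilbert set. finite B \<and> cspan B = UNIV)"
    and eq: "(scalar_tuple z :: ('h, 'n::finite) tuple) = scalar_tuple w"
  shows "z = w"
proof -
  have "cscale_op (z $ i - w $ i) (id_blinfun :: 'h \<Rightarrow>\<^sub>L 'h) = 0" for i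
    using arg_cong[OF eq, of "\<lambda>X. X $ i"] by (simp add: scalar_tuple_def cscale_op_diff_left)
  then have "cmod (z $ i - w $ i) = 0" for i
    using norm_cscale_op[of "z $ i - w $ i" "id_blinfun :: 'h \<Rightarrow>\<^sub>L 'h"] norm_id_infinite_dim[OF inf] by simp
  then show ?thesis
    by (simp add: vec_eq_iff)
qed

text \<open>Multiplying the identity by scalars is isometric, so operator norm convergence makes the
  scalar partial sums Cauchy; their limit is \<open>c\<close>.\<close>

lemma free_series_scalar:
  fixes f :: "('h::complex_hilbert, 'n::finite) tuple \<Rightarrow> ('h \<Rightarrow>\<^sub>L 'h)"
  assumes inf: "\<not> (\<exists>B :: 'h set. finite B \<and> cspan B = UNIV)"
    and f: "has_free_series f a" and z: "norm z < 1"
  obtains c where "f (scalar_tuple z) = cscale_op c id_blinfun"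
    "(\<lambda>k. \<Sum>\<alpha> | length \<alpha> = k. a \<alpha> * zword z \<alpha>) sums c"
proof -
  let ?g = "\<lambda>k. \<Sum>\<alpha> | length \<alpha> = k. a \<alpha> * zword z \<alpha>"
  define S where "S n = (\<Sum>k<n. ?g k)" for n
  have "hom_part a (scalar_tuple z) sums f (scalar_tuple z)"
    using z by (intro has_free_series_sums f) (simp add: scalar_tuple_in_nc_ball_iff[OF inf])
  then have lim: "(\<lambda>n. cscale_op (S n) id_blinfun) \<longlonglongrightarrow> f (scalar_tuple z)"
    by (simp add: sums_def hom_part_scalar_tuple S_def cscale_op_sum_left)
  then have "Cauchy (\<lambda>n. cscale_op (S n) (id_blinfun :: 'h \<Rightarrow>\<^sub>L 'h))"
    using LIMSEQ_imp_Cauchy by blast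
  then have "Cauchy S"
    by (simp add: Cauchy_def dist_norm norm_cscale_op norm_id_infinite_dim[OF inf]
        flip: cscale_op_diff_left)
  then obtain c where c: "S \<longlonglongrightarrow> c"
    using Cauchy_convergent convergent_def by blast
  then have "(\<lambda>n. cscale_op (S n) (id_blinfun :: 'h \<Rightarrow>\<^sub>L 'h)) \<longlonglongrightarrow> cscale_op c id_blinfun"
    by (rule bounded_linear.tendsto[OF bounded_linear_cscale_op_left])
  then have "f (scalar_tuple z) = cscale_op c id_blinfun"
    using lim LIMSEQ_unique by blast
  then show ?thesis
    by (rule that) (use c in \<open>simp add: sums_def S_def[abs_def]\<close>)
qed

text \<open>The definite description in \<open>scalar_rep\<close> denotes: each component takes a
  scalar value at a scalar point, and \<open>scalar_tuple\<close> is injective.\<close>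

lemma scalar_rep_eq:
  fixes \<phi> :: "('h::complex_hilbert, 'n::finite) tuple \<Rightarrow> ('h, 'n) tuple"
  assumes inf: "\<not> (\<exists>B :: 'h set. finite B \<and> cspan B = UNIV)"
    and \<phi>: "free_self_map \<phi>" and z: "norm z < 1"
  shows "\<phi> (scalar_tuple z) = scalar_tuple (scalar_rep \<phi> z)" "norm (scalar_rep \<phi> z) < 1"
proof -
  have "\<exists>c. \<phi> (scalar_tuple z) $ i = cscale_op c id_blinfun" for i
    using \<phi> free_series_scalar[OF inf _ z, of "\<lambda>X. \<phi> X $ i"]
    unfolding free_self_map_def free_holomorphic_def by metis
  then obtain w where "\<And>i. \<phi> (scalar_tuple z) $ i = cscale_op (w i) id_blinfun"
    by metis
  then have w: "\<phi> (scalar_tuple z) = scalar_tuple (\<chi> i. w i)"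
    by (simp add: scalar_tuple_def vec_eq_iff)
  show eq: "\<phi> (scalar_tuple z) = scalar_tuple (scalar_rep \<phi> z)"
    unfolding scalar_rep_def
    by (rule theI[of _ "\<chi> i. w i"]) (use w in \<open>auto dest: scalar_tuple_inject[OF inf]\<close>)
  have "\<phi> (scalar_tuple z) \<in> nc_ball"
    using \<phi> z scalar_tuple_in_nc_ball_iff[OF inf] unfolding free_self_map_def by blast
  then show "norm (scalar_rep \<phi> z) < 1"
    by (simp add: eq scalar_tuple_in_nc_ball_iff[OF inf])
qed

section \<open>Point evaluations on the Hardy space\<close>

lemma H2_coeff_summable:
  fixes f :: "('h::complex_hilbert, 'n::finite) tuple \<Rightarrow> ('h \<Rightarrow>\<^sub>L 'h)"
  assumes f: "f \<in> H2"
  defines "B \<equiv> \<lambda>k. \<Sum>\<alpha> | length \<alpha> = k. (cmod (free_coeff f \<alpha>))\<^sup>2"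
  shows "summable B" "suminf B \<le> (H2_norm f)\<^sup>2"
proof -
  have s: "(\<lambda>\<alpha>. (cmod (free_coeff f \<alpha>))\<^sup>2) summable_on UNIV"
    using f by (simp add: H2_def)
  have B0: "0 \<le> B k" for k
    by (simp add: B_def sum_nonneg)
  \<comment> \<open>Grouping by degree turns each partial sum into a finite subsum of the unordered
    sum over all words.\<close>
  have le: "(\<Sum>k<n. B k) \<le> (H2_norm f)\<^sup>2" for n
  proof -
    have "(\<Sum>k<n. B k) = (\<Sum>\<alpha>\<in>(\<Union>k<n. {\<alpha>. length \<alpha> = k}). (cmod (free_coeff f \<alpha>))\<^sup>2)"
      unfolding B_def by (rule sum.UNION_disjoint[symmetric]) auto
    also have "\<dots> \<le> (\<Sum>\<^sub>\<infinity>\<alpha>. (cmod (free_coeff f \<alpha>))\<^sup>2)"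
      by (rule finite_sum_le_infsum[OF s]) auto
    also have "\<dots> = (H2_norm f)\<^sup>2"
      by (simp add: H2_norm_def infsum_nonneg)
    finally show ?thesis .
  qed
  show "summable B"
    by (rule bounded_imp_summable[OF B0, where B = "(H2_norm f)\<^sup>2"])
      (use le[of "Suc _"] in \<open>simp add: lessThan_Suc_atMost\<close>)
  then show "suminf B \<le> (H2_norm f)\<^sup>2"
    by (rule suminf_le_const) (rule le)
qed

text \<open>An arbitrary finite index set is allowed so that ranges shifted by \<open>N\<close> are
  covered.\<close>

lemma sum_even_powers_le:
  fixes x :: real
  assumes "0 \<le> x" "x < 1" "finite A"
  shows "(\<Sum>k\<in>A. (x ^ k)\<^sup>2) \<le> 1 / (1 - x\<^sup>2)"
proof -
  have "x\<^sup>2 < 1" using assms by (simp add: power_less_one_iff)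
  then have s: "(\<lambda>k. (x\<^sup>2) ^ k) sums (1 / (1 - x\<^sup>2))"
    by (intro geometric_sums) simp
  have "(\<Sum>k\<in>A. (x\<^sup>2) ^ k) \<le> (\<Sum>k. (x\<^sup>2) ^ k)"
    using assms by (intro sum_le_suminf sums_summable[OF s]) auto
  then show ?thesis
    using sums_unique[OF s] by (simp add: mult.commute flip: power_mult)
qed

text \<open>
  Cauchy-Schwarz is applied only to the homogeneous parts of degree at least \<open>N\<close>: \<open>N = 0\<close> gives the norm of point
  evaluations, and \<open>N\<close> large shows that normalised point evaluations tend to 0 at the boundary.
\<close>

lemma H2_eval_le_split:
  fixes f :: "('h::complex_hilbert, 'n::finite) tuple \<Rightarrow> ('h \<Rightarrow>\<^sub>L 'h)"
  assumes inf: "\<not> (\<exists>B :: 'h set. finite B \<and> cspan B = UNIV)"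
    and f: "f \<in> H2" and z: "norm z < 1"
  defines "B \<equiv> \<lambda>k. \<Sum>\<alpha> | length \<alpha> = k. (cmod (free_coeff f \<alpha>))\<^sup>2"
  shows "norm (f (scalar_tuple z)) \<le>
    (\<Sum>k<N. sqrt (B k)) + sqrt (\<Sum>k. B (k + N)) / sqrt (1 - (norm z)\<^sup>2)"
proof -
  let ?a = "free_coeff f"
  have B0: "0 \<le> B k" for k
    by (simp add: B_def sum_nonneg)
  have sB: "summable (\<lambda>k. B (k + N))"
    using H2_coeff_summable(1)[OF f] unfolding B_def by (rule summable_ignore_initial_segment)
  have z2: "(norm z)\<^sup>2 < 1" using z by (simp add: power_less_one_iff)
  define g where "g k = (\<Sum>\<alpha> | length \<alpha> = k. ?a \<alpha> * zword z \<alpha>)" for k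
  have "has_free_series f ?a"
    using f has_free_series_coeff[OF inf] by (auto simp: H2_def)
  then obtain c where c: "f (scalar_tuple z) = cscale_op c id_blinfun" "g sums c"
    unfolding g_def[abs_def] by (rule free_series_scalar[OF inf _ z])
  \<comment> \<open>Cauchy-Schwarz over the words of length \<open>k\<close>; by
    \<open>sum_zword_norm\<close> the monomials contribute exactly
    \<open>norm z ^ k\<close>.\<close>
  have g: "cmod (g k) \<le> sqrt (B k) * norm z ^ k" for k
  proof -
    have "cmod (g k) \<le> (\<Sum>\<alpha> | length \<alpha> = k. \<bar>cmod (?a \<alpha>)\<bar> * \<bar>cmod (zword z \<alpha>)\<bar>)"
      unfolding g_def by (rule order_trans[OF norm_sum]) (simp add: norm_mult)
    also have "\<dots> \<le> L2_set (\<lambda>\<alpha>. cmod (?a \<alpha>)) {\<alpha>. length \<alpha> = k} * L2_set (\<lambda>\<alpha>. cmod (zword z \<alpha>)) {\<alpha>. length \<alpha> = k}"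
      by (rule L2_set_mult_ineq)
    also have "\<dots> = sqrt (B k) * norm z ^ k"
      by (simp add: L2_set_def B_def sum_zword_norm real_sqrt_power)
    finally show ?thesis .
  qed
  \<comment> \<open>In low degrees the powers of \<open>norm z\<close> are bounded by 1; in high
    degrees Cauchy-Schwarz is applied over \<open>k\<close>. The bound does not depend on
    \<open>m\<close>, so it survives the limit.\<close>
  have "norm (\<Sum>k<N + m. g k) \<le>
      (\<Sum>k<N. sqrt (B k)) + sqrt (\<Sum>k. B (k + N)) / sqrt (1 - (norm z)\<^sup>2)" for m
  proof -
    have "(\<Sum>k<N + m. g k) = (\<Sum>k<N. g k) + (\<Sum>k<m. g (k + N))"
      by (induction m) (simp_all add: add.commute add.assoc)
    then have "norm (\<Sum>k<N + m. g k) \<le> (\<Sum>k<N. cmod (g k)) + (\<Sum>k<m. cmod (g (k + N)))"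
      by (simp add: norm_triangle_mono norm_sum)
    also have "(\<Sum>k<N. cmod (g k)) \<le> (\<Sum>k<N. sqrt (B k))"
    proof (rule sum_mono)
      fix k
      have "sqrt (B k) * norm z ^ k \<le> sqrt (B k) * 1"
        using z B0 by (intro mult_left_mono power_le_one) auto
      then show "cmod (g k) \<le> sqrt (B k)"
        using g[of k] by simp
    qed
    also have "(\<Sum>k<m. cmod (g (k + N))) \<le> sqrt (\<Sum>k. B (k + N)) * (1 / sqrt (1 - (norm z)\<^sup>2))"
    proof -
      have "(\<Sum>k<m. cmod (g (k + N))) \<le> (\<Sum>k<m. \<bar>sqrt (B (k + N))\<bar> * \<bar>norm z ^ (k + N)\<bar>)"
        using g B0 by (intro sum_mono) simp
      also have "\<dots> \<le> L2_set (\<lambda>k. sqrt (B (k + N))) {..<m} * L2_set (\<lambda>k. norm z ^ (k + N)) {..<m}"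
        by (rule L2_set_mult_ineq)
      also have "\<dots> \<le> sqrt (\<Sum>k. B (k + N)) * (1 / sqrt (1 - (norm z)\<^sup>2))"
      proof (intro mult_mono L2_set_nonneg)
        have "(\<Sum>k<m. B (k + N)) \<le> (\<Sum>k. B (k + N))"
          by (rule sum_le_suminf[OF sB]) (auto simp: B0)
        then show "L2_set (\<lambda>k. sqrt (B (k + N))) {..<m} \<le> sqrt (\<Sum>k. B (k + N))"
          by (simp add: L2_set_def B0)
        have "(\<Sum>k<m. (norm z ^ (k + N))\<^sup>2) = (\<Sum>k\<in>(\<lambda>k. k + N) ` {..<m}. (norm z ^ k)\<^sup>2)"
          by (simp add: sum.reindex)
        also have "\<dots> \<le> 1 / (1 - (norm z)\<^sup>2)"
          by (intro sum_even_powers_le) (use z in auto)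
        finally show "L2_set (\<lambda>k. norm z ^ (k + N)) {..<m} \<le> 1 / sqrt (1 - (norm z)\<^sup>2)"
          unfolding L2_set_def by (metis real_sqrt_divide real_sqrt_le_mono real_sqrt_one)
        show "0 \<le> sqrt (\<Sum>k. B (k + N))"
          using suminf_nonneg[OF sB] B0 by simp
      qed
      finally show ?thesis .
    qed
    finally show ?thesis by simp
  qed
  moreover have "(\<lambda>m. norm (\<Sum>k<N + m. g k)) \<longlonglongrightarrow> cmod c"
    using LIMSEQ_ignore_initial_segment[OF c(2)[unfolded sums_def], of N]
    by (intro tendsto_norm) (simp add: add.commute)
  ultimately have "cmod c \<le> (\<Sum>k<N. sqrt (B k)) + sqrt (\<Sum>k. B (k + N)) / sqrt (1 - (norm z)\<^sup>2)"
    by (intro LIMSEQ_le_const2) auto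
  then show ?thesis
    by (simp add: c norm_cscale_op norm_id_infinite_dim[OF inf])
qed

text \<open>The weight is the reciprocal of the norm of the reproducing kernel at \<open>z\<close>,
  which makes weighted evaluation a contraction.\<close>

lemma H2_eval_le:
  fixes f :: "('h::complex_hilbert, 'n::finite) tuple \<Rightarrow> ('h \<Rightarrow>\<^sub>L 'h)"
  assumes inf: "\<not> (\<exists>B :: 'h set. finite B \<and> cspan B = UNIV)"
    and f: "f \<in> H2" and z: "norm z < 1"
  shows "sqrt (1 - (norm z)\<^sup>2) * norm (f (scalar_tuple z)) \<le> H2_norm f"
proof -
  let ?B = "\<lambda>k. \<Sum>\<alpha> | length \<alpha> = k. (cmod (free_coeff f \<alpha>))\<^sup>2"
  have z2: "(norm z)\<^sup>2 < 1" using z by (simp add: power_less_one_iff)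
  have "0 \<le> H2_norm f"
    by (simp add: H2_norm_def infsum_nonneg)
  then have "sqrt (suminf ?B) \<le> H2_norm f"
    using H2_coeff_summable(2)[OF f] by (simp add: real_le_lsqrt)
  moreover have "norm (f (scalar_tuple z)) \<le> sqrt (suminf ?B) / sqrt (1 - (norm z)\<^sup>2)"
    using H2_eval_le_split[OF assms, of 0] by simp
  ultimately show ?thesis
    using z2 by (simp add: field_simps)
qed

lemma H2_eval_vanish:
  fixes f :: "('h::complex_hilbert, 'n::finite) tuple \<Rightarrow> ('h \<Rightarrow>\<^sub>L 'h)"
  assumes inf: "\<not> (\<exists>B :: 'h set. finite B \<and> cspan B = UNIV)"
    and f: "f \<in> H2" and z: "\<And>j::nat. norm (z j) < 1" and lim: "(\<lambda>j. norm (z j)) \<longlonglongrightarrow> 1"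
  shows "(\<lambda>j. sqrt (1 - (norm (z j))\<^sup>2) * norm (f (scalar_tuple (z j)))) \<longlonglongrightarrow> 0"
proof (rule LIMSEQ_I)
  fix e :: real assume e: "0 < e"
  let ?B = "\<lambda>k. \<Sum>\<alpha> | length \<alpha> = k. (cmod (free_coeff f \<alpha>))\<^sup>2"
  have "0 < (e / 2)\<^sup>2" using e by simp
  \<comment> \<open>\<open>N\<close> depends on the coefficients alone, so the tail estimate is
    uniform in \<open>j\<close>.\<close>
  then obtain N where "norm (\<Sum>k. ?B (k + N)) < (e / 2)\<^sup>2"
    using suminf_exist_split[OF _ H2_coeff_summable(1)[OF f]] by blast
  then have "sqrt (\<Sum>k. ?B (k + N)) < sqrt ((e / 2)\<^sup>2)"
    by (intro real_sqrt_less_mono) simp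
  then have tail: "sqrt (\<Sum>k. ?B (k + N)) < e / 2"
    using e by simp
  define C where "C = (\<Sum>k<N. sqrt (?B k))"
  \<comment> \<open>With \<open>N\<close> fixed, \<open>C\<close> is constant and the weight sends
    the low degrees to 0.\<close>
  have "(\<lambda>j. sqrt (1 - (norm (z j))\<^sup>2) * C) \<longlonglongrightarrow> sqrt (1 - 1\<^sup>2) * C"
    by (intro tendsto_intros lim)
  then obtain j0 where j0: "\<And>j. j \<ge> j0 \<Longrightarrow> \<bar>sqrt (1 - (norm (z j))\<^sup>2) * C\<bar> < e / 2"
    using LIMSEQ_D[of _ 0 "e / 2"] e by fastforce
  have "norm (sqrt (1 - (norm (z j))\<^sup>2) * norm (f (scalar_tuple (z j))) - 0) < e" if "j \<ge> j0" for j
  proof -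
    let ?s = "sqrt (1 - (norm (z j))\<^sup>2)"
    have s: "0 < ?s" using z[of j] by (simp add: power_less_one_iff)
    have "?s * norm (f (scalar_tuple (z j))) \<le> ?s * (C + sqrt (\<Sum>k. ?B (k + N)) / ?s)"
      unfolding C_def by (intro mult_left_mono H2_eval_le_split inf f z) (use s in simp)
    also have "\<dots> = ?s * C + sqrt (\<Sum>k. ?B (k + N))"
      using s by (simp add: distrib_left)
    also have "\<dots> < e"
      using j0[OF that] tail by simp
    finally show ?thesis
      using s by simp
  qed
  then show "\<exists>no. \<forall>j\<ge>no. norm (sqrt (1 - (norm (z j))\<^sup>2) * norm (f (scalar_tuple (z j))) - 0) < e"
    by blast
qed

section \<open>Reproducing kernels\<close>

text \<open>Multiplicative coefficients let the first letter split off as a factor; complex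
  linearity of each \<open>X $ i\<close> moves the remaining scalars through.\<close>

lemma hom_part_Suc_zword:
  "hom_part (zword v) X (Suc k) = (\<Sum>i\<in>UNIV. cscale_op (v $ i) (X $ i)) o\<^sub>L hom_part (zword v) X k"
  if "\<And>i. X $ i \<in> BH" for X :: "('h::complex_hilbert, 'n::finite) tuple"
  unfolding hom_part_def sum_words_Suc using that
  by (intro blinfun_eqI)
    (simp add: blinfun.sum_left blinfun.sum_right BH_def scaleC_scaleC
      complex_vector.scale_sum_right sum.swap[of _ "{\<alpha>. length \<alpha> = k}"])

text \<open>Each factor split off is a row combination of norm at most \<open>norm v\<close>,
  because \<open>X\<close> is a row contraction.\<close>

lemma norm_hom_part_zword_le:
  fixes X :: "('h::complex_hilbert, 'n::finite) tuple"
  assumes X: "X \<in> nc_ball"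
  shows "norm (hom_part (zword v) X k) \<le> norm v ^ k"
proof (induction k)
  case 0
  show ?case
    by (simp add: hom_part_def norm_cscale_op norm_blinfun_id_le)
next
  case (Suc k)
  have XB: "\<And>i. X $ i \<in> BH" and X1: "sqrt (norm (\<Sum>i\<in>UNIV. X $ i o\<^sub>L adj_op (X $ i))) \<le> 1"
    using X by (auto simp: nc_ball_def)
  let ?T = "\<Sum>i\<in>UNIV. cscale_op (v $ i) (X $ i)"
  have "norm ?T \<le> norm v * 1"
    by (rule order_trans[OF norm_row_operator_le[OF XB] mult_left_mono[OF X1]]) simp
  then have "norm (?T o\<^sub>L hom_part (zword v) X k) \<le> norm v * norm v ^ k"
    by (intro order_trans[OF norm_blinfun_compose] mult_mono Suc) auto
  then show ?case
    by (simp add: hom_part_Suc_zword[OF XB])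
qed

text \<open>
  The function is the reproducing kernel at \<open>w\<close>, normalised. Its homogeneous part of degree \<open>k\<close> is, up to the
  normalisation, the \<open>k\<close>-th power of the row combination \<open>\<Sum>\<^sub>i cnj w\<^sub>i X\<^sub>i\<close>, so the series is geometric.
\<close>

lemma normalised_kernel_exists:
  fixes w :: "complex^'n::finite"
  assumes inf: "\<not> (\<exists>B :: 'h::complex_hilbert set. finite B \<and> cspan B = UNIV)"
    and w: "norm w < 1"
  shows "\<exists>f :: ('h, 'n) tuple \<Rightarrow> ('h \<Rightarrow>\<^sub>L 'h). f \<in> H2 \<and> H2_norm f \<le> 1 \<and>
    norm (f (scalar_tuple w)) = 1 / sqrt (1 - (norm w)\<^sup>2)"
proof -
  \<comment> \<open>Conjugation makes the pairing of \<open>v\<close> with \<open>w\<close> equal to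
    the squared norm of \<open>w\<close>.\<close>
  define v where "v = (\<chi> i. cnj (w $ i))"
  have nv: "norm v = norm w"
    by (simp add: v_def norm_vec_def)
  define s where "s = sqrt (1 - (norm w)\<^sup>2)"
  have w2: "(norm w)\<^sup>2 < 1"
    using w by (simp add: power_less_one_iff)
  then have s: "0 < s" "s\<^sup>2 = 1 - (norm w)\<^sup>2"
    by (simp_all add: s_def)
  define a where "a \<alpha> = complex_of_real s * zword v \<alpha>" for \<alpha>
  have hom: "hom_part a X k = cscale_op s (hom_part (zword v) X k)" for X :: "('h, 'n) tuple" and k
    by (simp add: hom_part_def a_def cscale_op_sum_right cscale_op_cscale_op)
  define f :: "('h, 'n) tuple \<Rightarrow> ('h \<Rightarrow>\<^sub>L 'h)"
    where "f X = (if X \<in> nc_ball then \<Sum>k. hom_part a X k else 0)" for X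
  have geom: "(\<lambda>k. ((norm w)\<^sup>2) ^ k) sums (1 / (1 - (norm w)\<^sup>2))"
    using w2 by (intro geometric_sums) simp
  have fin: "(\<Sum>\<alpha>\<in>F. (cmod (a \<alpha>))\<^sup>2) \<le> 1" if "finite F" for F
  proof -
    \<comment> \<open>All words of \<open>F\<close> have length below \<open>n\<close>; inserting 0
      keeps the maximum defined for empty \<open>F\<close>.\<close>
    define n where "n = Suc (Max (insert 0 (length ` F)))"
    have "length \<alpha> < n" if "\<alpha> \<in> F" for \<alpha>
      using that \<open>finite F\<close> by (auto simp: n_def less_Suc_eq_le Max_ge_iff)
    then have "(\<Sum>\<alpha>\<in>F. (cmod (a \<alpha>))\<^sup>2) \<le> (\<Sum>\<alpha>\<in>(\<Union>k<n. {\<alpha>. length \<alpha> = k}). (cmod (a \<alpha>))\<^sup>2)"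
      by (intro sum_mono2) auto
    also have "\<dots> = (\<Sum>k<n. \<Sum>\<alpha> | length \<alpha> = k. (cmod (a \<alpha>))\<^sup>2)"
      by (rule sum.UNION_disjoint) auto
    also have "\<dots> = s\<^sup>2 * (\<Sum>k<n. ((norm w)\<^sup>2) ^ k)"
      by (simp add: a_def norm_mult power_mult_distrib sum_zword_norm nv flip: sum_distrib_left)
    also have "\<dots> \<le> s\<^sup>2 * (1 / (1 - (norm w)\<^sup>2))"
      unfolding sums_unique[OF geom]
      by (intro mult_left_mono sum_le_suminf sums_summable[OF geom]) auto
    also have "\<dots> = 1"
      using s w2 by simp
    finally show ?thesis .
  qed
  have sa: "(\<lambda>\<alpha>. (cmod (a \<alpha>))\<^sup>2) summable_on UNIV"
    by (rule nonneg_bdd_above_summable_on) (auto intro!: bdd_aboveI2 fin)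
  have sums: "hom_part a X sums f X" if X: "X \<in> nc_ball" for X
  proof -
    have "summable (\<lambda>k. norm v ^ k)"
      using w by (intro summable_geometric) (simp add: nv)
    then have "summable (hom_part (zword v) X)"
      using norm_hom_part_zword_le[OF X] by (rule summable_comparison_test'[where N = 0])
    then have "summable (hom_part a X)"
      unfolding hom[abs_def] by (rule bounded_linear.summable[OF bounded_linear_cscale_op_right])
    then show ?thesis
      using X by (simp add: f_def summable_sums)
  qed
  have off: "f X = 0" if "X \<notin> nc_ball" for X
    using that by (simp add: f_def)
  note f = H2_intro[OF inf sa sums off]
  have "H2_norm f \<le> 1"
    using infsum_le_finite_sums[OF sa fin] by (simp add: H2_norm_def f)
  moreover have "norm (f (scalar_tuple w)) = 1 / sqrt (1 - (norm w)\<^sup>2)"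
  proof -
    have w_in: "(scalar_tuple w :: ('h, 'n) tuple) \<in> nc_ball"
      using w by (simp add: scalar_tuple_in_nc_ball_iff[OF inf])
    have vw: "(\<Sum>i\<in>UNIV. v $ i * w $ i) = complex_of_real ((norm w)\<^sup>2)"
      unfolding norm_vec_power2 of_real_sum
      by (intro sum.cong) (simp_all add: v_def complex_norm_square mult.commute del: of_real_power)
    have hom_w: "hom_part a (scalar_tuple w) k =
        cscale_op (complex_of_real (s * ((norm w)\<^sup>2) ^ k)) (id_blinfun :: 'h \<Rightarrow>\<^sub>L 'h)" for k
    proof -
      have "hom_part (zword v) (scalar_tuple w) k =
          cscale_op (complex_of_real (((norm w)\<^sup>2) ^ k)) (id_blinfun :: 'h \<Rightarrow>\<^sub>L 'h)"
        by (simp only: hom_part_scalar_tuple sum_zword_mult vw of_real_power)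
      then show ?thesis
        by (simp only: hom cscale_op_cscale_op of_real_mult)
    qed
    have "hom_part a (scalar_tuple w) sums
        cscale_op (complex_of_real (s * (1 / (1 - (norm w)\<^sup>2)))) (id_blinfun :: 'h \<Rightarrow>\<^sub>L 'h)"
      unfolding hom_w[abs_def]
      by (rule bounded_linear.sums[OF bounded_linear_cscale_op_left sums_of_real[OF sums_mult[OF geom]]])
    then have "f (scalar_tuple w) = cscale_op (complex_of_real (s * (1 / s\<^sup>2))) id_blinfun"
      unfolding s(2) by (rule sums_unique2[OF sums[OF w_in]])
    also have "s * (1 / s\<^sup>2) = 1 / s"
      using s(1) by (simp add: power2_eq_square)
    finally show ?thesis
      using s(1) by (simp add: norm_cscale_op norm_id_infinite_dim[OF inf] norm_divide flip: s_def)
  qed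
  ultimately show ?thesis
    using f(1) by (intro exI[of _ f]) simp
qed

section \<open>The essential norm and angular derivatives\<close>

text \<open>Along a subsequence \<open>K (f j)\<close> converges in norm to some \<open>g\<close>.
  Weighted evaluation of the difference is bounded by its norm, and that of the fixed
  \<open>g\<close> vanishes at the boundary.\<close>

lemma H2_compact_normalised_eval_vanish:
  fixes K :: "('h::complex_hilbert, 'n::finite) H2_op"
  assumes inf: "\<not> (\<exists>B :: 'h set. finite B \<and> cspan B = UNIV)"
    and K: "H2_compact K" and f: "\<And>j::nat. f j \<in> H2" "\<And>j. H2_norm (f j) \<le> 1"
    and z: "\<And>j. norm (z j) < 1" "(\<lambda>j. norm (z j)) \<longlonglongrightarrow> 1"
  obtains r :: "nat \<Rightarrow> nat" where "strict_mono r"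
    "(\<lambda>j. sqrt (1 - (norm (z (r j)))\<^sup>2) * norm (K (f (r j)) (scalar_tuple (z (r j))))) \<longlonglongrightarrow> 0"
proof -
  obtain g r where g: "g \<in> H2" and r: "strict_mono (r :: nat \<Rightarrow> nat)"
    and lim: "(\<lambda>j. H2_norm (\<lambda>X. K (f (r j)) X - g X)) \<longlonglongrightarrow> 0"
    using K f unfolding H2_compact_def by blast
  have KH: "K (f j) \<in> H2" for j
    using K f by (simp add: H2_compact_def H2_linear_def)
  define q where "q j = sqrt (1 - (norm (z (r j)))\<^sup>2)" for j
  have q: "0 \<le> q j" for j
    using z(1)[of "r j"] by (simp add: q_def power_le_one)
  have "(\<lambda>j. q j * norm (g (scalar_tuple (z (r j))))) \<longlonglongrightarrow> 0"
    unfolding q_def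
    by (rule H2_eval_vanish[OF inf g]) (use z LIMSEQ_subseq_LIMSEQ[OF z(2) r] in \<open>auto simp: o_def\<close>)
  then have "(\<lambda>j. H2_norm (\<lambda>X. K (f (r j)) X - g X) + q j * norm (g (scalar_tuple (z (r j))))) \<longlonglongrightarrow> 0 + 0"
    by (intro tendsto_add lim)
  then have "(\<lambda>j. H2_norm (\<lambda>X. K (f (r j)) X - g X) + q j * norm (g (scalar_tuple (z (r j))))) \<longlonglongrightarrow> 0"
    by simp
  then have "(\<lambda>j. q j * norm (K (f (r j)) (scalar_tuple (z (r j))))) \<longlonglongrightarrow> 0"
  proof (rule Lim_null_comparison[rotated])
    show "\<forall>\<^sub>F j in sequentially. norm (q j * norm (K (f (r j)) (scalar_tuple (z (r j))))) \<le>
        H2_norm (\<lambda>X. K (f (r j)) X - g X) + q j * norm (g (scalar_tuple (z (r j))))"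
    proof (intro always_eventually allI)
      fix j
      let ?x = "scalar_tuple (z (r j)) :: ('h, 'n) tuple"
      have "q j * norm (K (f (r j)) ?x) \<le> q j * (norm (K (f (r j)) ?x - g ?x) + norm (g ?x))"
        by (intro mult_left_mono q) (metis norm_triangle_sub add.commute)
      also have "\<dots> \<le> H2_norm (\<lambda>X. K (f (r j)) X - g X) + q j * norm (g ?x)"
        using H2_eval_le[OF inf H2_diff[OF inf KH g] z(1)] by (simp add: q_def distrib_left)
      finally show "norm (q j * norm (K (f (r j)) ?x)) \<le>
          H2_norm (\<lambda>X. K (f (r j)) X - g X) + q j * norm (g ?x)"
        using q by simp
    qed
  qed
  then show ?thesis
    using that r by (simp add: q_def)
qed

text \<open>\<open>bound\<close> says that \<open>M\<close> is admissible in the infimum defining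
  the operator norm of the difference. The filter expresses that \<open>norm z\<close> tends to 1
  from below, with no restriction on direction.\<close>

lemma Limsup_le_of_compact_perturbation:
  fixes \<phi> :: "('h::complex_hilbert, 'n::finite) tuple \<Rightarrow> ('h, 'n) tuple"
  assumes inf: "\<not> (\<exists>B :: 'h set. finite B \<and> cspan B = UNIV)"
    and \<phi>: "free_self_map \<phi>" and K: "H2_compact K" and M: "0 \<le> M"
    and bound: "\<And>f. f \<in> H2 \<Longrightarrow> (\<lambda>X. comp_op \<phi> f X - K f X) \<in> H2 \<and>
      H2_norm (\<lambda>X. comp_op \<phi> f X - K f X) \<le> M * H2_norm f"
  shows "Limsup (filtercomap norm (at_left 1))
      (\<lambda>z. ereal (sqrt ((1 - (norm z)\<^sup>2) / (1 - (norm (scalar_rep \<phi> z))\<^sup>2)))) \<le> ereal M"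
proof -
  define Q where "Q z = sqrt ((1 - (norm z)\<^sup>2) / (1 - (norm (scalar_rep \<phi> z))\<^sup>2))" for z
  have "eventually (\<lambda>z. Q z \<le> c) (filtercomap norm (at_left 1))" if c: "M < c" for c
  proof (rule ccontr)
    assume *: "\<not> eventually (\<lambda>z. Q z \<le> c) (filtercomap norm (at_left 1))"
    \<comment> \<open>Otherwise the bound by \<open>c\<close> would hold on a whole shell next to
      the sphere, hence eventually.\<close>
    have "\<exists>z. 1 - 1 / (real j + 1) < norm z \<and> norm z < 1 \<and> c < Q z" for j :: nat
    proof (rule ccontr)
      assume "\<not> ?thesis"
      then have "\<forall>z. 1 - 1 / (real j + 1) < norm z \<and> norm z < 1 \<longrightarrow> Q z \<le> c"
        by (meson not_less)
      moreover have "eventually (\<lambda>y. 1 - 1 / (real j + 1) < y \<and> y < 1) (at_left 1)"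
        unfolding eventually_at_left_field by (intro exI[of _ "1 - 1 / (real j + 1)"]) simp
      ultimately show False
        using * unfolding eventually_filtercomap by blast
    qed
    then obtain z where z: "\<And>j. 1 - 1 / (real j + 1) < norm (z j)" "\<And>j::nat. norm (z j) < 1"
      "\<And>j. c < Q (z j)"
      by metis
    have zlim: "(\<lambda>j. norm (z j)) \<longlonglongrightarrow> 1"
    proof (rule tendsto_sandwich)
      have "(\<lambda>j. 1 - inverse (real (Suc j))) \<longlonglongrightarrow> 1 - 0"
        by (intro tendsto_intros LIMSEQ_inverse_real_of_nat)
      then show "(\<lambda>j. 1 - 1 / (real j + 1)) \<longlonglongrightarrow> 1"
        by (simp add: inverse_eq_divide add.commute)
    qed (use z in \<open>auto intro!: always_eventually less_imp_le\<close>)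
    define w where "w j = scalar_rep \<phi> (z j)" for j
    have w: "\<phi> (scalar_tuple (z j)) = scalar_tuple (w j)" "norm (w j) < 1" for j
      using scalar_rep_eq[OF inf \<phi> z(2)] by (simp_all add: w_def)
    obtain f :: "nat \<Rightarrow> ('h, 'n) tuple \<Rightarrow> ('h \<Rightarrow>\<^sub>L 'h)"
      where f: "\<And>j. f j \<in> H2" "\<And>j. H2_norm (f j) \<le> 1"
        "\<And>j. norm (f j (scalar_tuple (w j))) = 1 / sqrt (1 - (norm (w j))\<^sup>2)"
      using normalised_kernel_exists[OF inf w(2)] by metis
    obtain r :: "nat \<Rightarrow> nat" where r: "strict_mono r"
      "(\<lambda>j. sqrt (1 - (norm (z (r j)))\<^sup>2) * norm (K (f (r j)) (scalar_tuple (z (r j))))) \<longlonglongrightarrow> 0"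
      by (rule H2_compact_normalised_eval_vanish[OF inf K f(1,2) z(2) zlim])
    have "c \<le> M + sqrt (1 - (norm (z j))\<^sup>2) * norm (K (f j) (scalar_tuple (z j)))" for j
    proof -
      let ?x = "scalar_tuple (z j) :: ('h, 'n) tuple"
      let ?s = "sqrt (1 - (norm (z j))\<^sup>2)"
      have s: "0 \<le> ?s"
        using z(2)[of j] by (simp add: power_le_one)
      have comp: "comp_op \<phi> (f j) ?x = f j (scalar_tuple (w j))"
        using z(2)[of j] by (simp add: comp_op_def scalar_tuple_in_nc_ball_iff[OF inf] w)
      have "c \<le> Q (z j)"
        using z(3)[of j] by simp
      \<comment> \<open>The kernel \<open>f j\<close> was chosen at \<open>w j\<close>, the image of
        \<open>z j\<close>, so this value realises the quotient exactly.\<close>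
      also have "\<dots> = ?s * norm (comp_op \<phi> (f j) ?x)"
        unfolding comp f(3) by (simp add: Q_def w_def real_sqrt_divide)
      also have "\<dots> \<le> ?s * (norm (comp_op \<phi> (f j) ?x - K (f j) ?x) + norm (K (f j) ?x))"
        by (intro mult_left_mono s) (metis norm_triangle_sub add.commute)
      also have "\<dots> \<le> M * H2_norm (f j) + ?s * norm (K (f j) ?x)"
        using H2_eval_le[OF inf conjunct1[OF bound[OF f(1)]] z(2), of j j] bound[OF f(1), of j]
        by (simp add: distrib_left)
      also have "\<dots> \<le> M * 1 + ?s * norm (K (f j) ?x)"
        by (intro add_right_mono mult_left_mono f M)
      finally show ?thesis by simp
    qed
    moreover have "(\<lambda>j. M + sqrt (1 - (norm (z (r j)))\<^sup>2) * norm (K (f (r j)) (scalar_tuple (z (r j))))) \<longlonglongrightarrow> M + 0"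
      by (intro tendsto_add tendsto_const r(2))
    ultimately have "c \<le> M + 0"
      by (intro LIMSEQ_le_const) auto
    with c show False by simp
  qed
  \<comment> \<open>Only \<open>c\<close> above \<open>M\<close> were treated; taking
    \<open>c = M + e\<close> with arbitrary positive \<open>e\<close> recovers
    \<open>M\<close>.\<close>
  then have "Limsup (filtercomap norm (at_left 1)) (\<lambda>z. ereal (Q z)) \<le> ereal c" if "M < c" for c
    using that by (intro Limsup_bounded) simp
  then have "Limsup (filtercomap norm (at_left 1)) (\<lambda>z. ereal (Q z)) \<le> ereal M + ereal e" if "0 < e" for e
    using that by simp
  then show ?thesis
    unfolding Q_def by (rule ereal_le_epsilon2)
qed

text \<open>Up to a factor 2, squared and unsquared norms give comparable distances to the sphere. A
  vanishing quotient therefore forces its reciprocal without squares to infinity.\<close>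

lemma not_finite_angular_derivative:
  fixes \<psi> :: "complex^'n::finite \<Rightarrow> complex^'n"
  assumes \<psi>: "\<And>z. norm z < 1 \<Longrightarrow> norm (\<psi> z) < 1"
    and lim: "Limsup (filtercomap norm (at_left 1))
      (\<lambda>z. ereal (sqrt ((1 - (norm z)\<^sup>2) / (1 - (norm (\<psi> z))\<^sup>2)))) \<le> 0"
    and \<xi>: "norm \<xi> = 1"
  shows "\<not> finite_angular_derivative \<psi> \<xi>"
proof
  let ?F = "at \<xi> within ball 0 1"
  assume "finite_angular_derivative \<psi> \<xi>"
  then have "Liminf ?F (\<lambda>z. ereal ((1 - norm (\<psi> z)) / (1 - norm z))) \<noteq> \<infinity>"
    by (simp add: finite_angular_derivative_def)
  then obtain n :: nat where n: "Liminf ?F (\<lambda>z. ereal ((1 - norm (\<psi> z)) / (1 - norm z))) < ereal (real n)"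
    unfolding less_PInf_Ex_of_nat ..
  \<comment> \<open>Adding 1 ensures positivity even for \<open>n = 0\<close>, so that
    \<open>1 / (2 * L)\<close> is a positive threshold.\<close>
  define L where "L = real n + 1"
  have L: "Liminf ?F (\<lambda>z. ereal ((1 - norm (\<psi> z)) / (1 - norm z))) < ereal L" "0 < L"
    using n by (auto simp: L_def intro: less_trans)
  have in_ball: "eventually (\<lambda>z. norm z < 1) ?F"
    by (auto simp: eventually_at_filter)
  \<comment> \<open>Any approach to a boundary point from inside the ball makes the norm tend to 1
    from below, so eventual bounds transfer to \<open>?F\<close>.\<close>
  have "filterlim norm (at_left 1) ?F"
    unfolding filterlim_at
    using in_ball \<xi> by (auto intro!: tendsto_eq_intros elim: eventually_mono)
  then have F: "?F \<le> filtercomap norm (at_left 1)"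
    by (simp add: filterlim_iff_le_filtercomap)
  \<comment> \<open>The factor 2 in the threshold pays for
    \<open>1 - b\<^sup>2 \<le> 2 * (1 - b)\<close> below.\<close>
  have "Limsup (filtercomap norm (at_left 1))
      (\<lambda>z. ereal (sqrt ((1 - (norm z)\<^sup>2) / (1 - (norm (\<psi> z))\<^sup>2)))) < ereal (sqrt (1 / (2 * L)))"
    using lim L(2) by (simp add: le_less_trans)
  then have "eventually (\<lambda>z. ereal (sqrt ((1 - (norm z)\<^sup>2) / (1 - (norm (\<psi> z))\<^sup>2))) < ereal (sqrt (1 / (2 * L))))
      (filtercomap norm (at_left 1))"
    by (rule Limsup_lessD)
  then have "eventually (\<lambda>z. ereal (sqrt ((1 - (norm z)\<^sup>2) / (1 - (norm (\<psi> z))\<^sup>2))) < ereal (sqrt (1 / (2 * L)))) ?F"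
    using F by (rule filter_leD[rotated])
  then have "eventually (\<lambda>z. ereal L \<le> ereal ((1 - norm (\<psi> z)) / (1 - norm z))) ?F"
    using in_ball
  proof eventually_elim
    case (elim z)
    define a b where "a = norm z" and "b = norm (\<psi> z)"
    have a: "0 \<le> a" "a < 1" and b: "0 \<le> b" "b < 1"
      using elim \<psi> by (auto simp: a_def b_def)
    have b2: "b\<^sup>2 < 1"
      using b by (simp add: power_less_one_iff)
    have "(1 - a\<^sup>2) / (1 - b\<^sup>2) < 1 / (2 * L)"
      using elim by (simp add: a_def b_def)
    then have "2 * L * (1 - a\<^sup>2) < 1 - b\<^sup>2"
      using b2 L(2) by (simp add: field_simps)
    moreover have "1 - b\<^sup>2 \<le> 2 * (1 - b)"
      using zero_le_power2[of "1 - b"] by (simp add: power2_eq_square algebra_simps)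
    moreover have "L * (1 - a) \<le> L * (1 - a\<^sup>2)"
      using a L(2) by (intro mult_left_mono) (auto simp: power2_eq_square mult_left_le)
    ultimately have "L * (1 - a) \<le> 1 - b"
      by simp
    then show ?case
      using a by (simp add: a_def b_def pos_le_divide_eq)
  qed
  then have "ereal L \<le> Liminf ?F (\<lambda>z. ereal ((1 - norm (\<psi> z)) / (1 - norm z)))"
    by (rule Liminf_bounded)
  with L(1) show False by simp
qed

theorem theorem5p4:
  fixes \<phi> :: "('h::complex_hilbert, 'n::finite) tuple \<Rightarrow> ('h, 'n) tuple"
  assumes separable: "separable_space (euclidean :: 'h topology)"
    and infinite_dim: "\<not> (\<exists>B :: 'h set. finite B \<and> cspan B = UNIV)"
    and self_map: "free_self_map \<phi>"
  shows "H2_ess_norm (comp_op \<phi>) \<ge>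
           Limsup (filtercomap norm (at_left 1))
             (\<lambda>z. ereal (sqrt ((1 - (norm z)\<^sup>2) / (1 - (norm (scalar_rep \<phi> z))\<^sup>2))))
         \<and> (H2_compact (comp_op \<phi>) \<longrightarrow>
              (\<forall>\<xi>\<in>sphere 0 1. \<not> finite_angular_derivative (scalar_rep \<phi>) \<xi>))"
proof (intro conjI impI ballI)
  \<comment> \<open>Both norms are infima, so it suffices to bound the limit superior by every
    admissible \<open>M\<close> for every compact \<open>K\<close>; if no \<open>M\<close> is
    admissible, the infimum is infinite.\<close>
  show i: "Limsup (filtercomap norm (at_left 1))
             (\<lambda>z. ereal (sqrt ((1 - (norm z)\<^sup>2) / (1 - (norm (scalar_rep \<phi> z))\<^sup>2))))
           \<le> H2_ess_norm (comp_op \<phi>)"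
    unfolding H2_ess_norm_def H2_opnorm_def
    by (intro INF_greatest)
      (auto intro!: Limsup_le_of_compact_perturbation[OF infinite_dim self_map])
  fix \<xi> :: "complex^'n"
  assume compact: "H2_compact (comp_op \<phi>)" and \<xi>: "\<xi> \<in> sphere 0 1"
  \<comment> \<open>A compact composition operator is its own compact approximant, and the bound 0
    is admissible for the zero difference.\<close>
  have "H2_ess_norm (comp_op \<phi>) \<le> H2_opnorm (\<lambda>f X. comp_op \<phi> f X - comp_op \<phi> f X)"
    unfolding H2_ess_norm_def using compact by (intro INF_lower) simp
  also have "\<dots> \<le> ereal 0"
    unfolding H2_opnorm_def by (intro INF_lower) (simp add: H2_zero[OF infinite_dim])
  finally have "H2_ess_norm (comp_op \<phi>) \<le> 0"
    by (simp add: zero_ereal_def)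
  with i have lim: "Limsup (filtercomap norm (at_left 1))
      (\<lambda>z. ereal (sqrt ((1 - (norm z)\<^sup>2) / (1 - (norm (scalar_rep \<phi> z))\<^sup>2)))) \<le> 0"
    by (rule order_trans)
  show "\<not> finite_angular_derivative (scalar_rep \<phi>) \<xi>"
    using scalar_rep_eq(2)[OF infinite_dim self_map] lim
  proof (rule not_finite_angular_derivative)
    show "norm \<xi> = 1"
      using \<xi> by simp
  qed
qed

end
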